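(* Let $\alpha\in\mathbb C$, let $n\in\mathbb N_0$, and let $(s_j)_{j=0}^{2n+1}\in\tilde{\mathcal D}_{p\times q,2n+1}$. Then: (a) $K_n^{\sharp,\alpha}=-S_n^{\sharp,\alpha}K_n^{[+,\alpha]}\mathbb S_n^{\sharp,\alpha}$ and $K_n^{\sharp,\alpha}=-R_{q,n}(\alpha)\,S_n^\dagger\,H_{\alpha,n}\,\mathbb S_n^\dagger\,[R_{p,n}(\overline\alpha)]^*$. (b) $K_n^{[+,\alpha]}=\Xi_{n,2n+1}-S_n^{[+,\alpha]}K_n^{\sharp,\alpha}\mathbb S_n^{[+,\alpha]}$. (c) $\operatorname{rank}K_n^{\sharp,\alpha}=\operatorname{rank}(K_n^{[+,\alpha]}-\Xi_{n,2n+1})$. (d) If $p=q$, then $\det(K_n^{\sharp,\alpha})=[(\det s_0)^\dagger]^{2n+2}\det(-K_n^{[+,\alpha]})$.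
   Context: Let $p,q\in\mathbb N=\{1,2,\dots\}$; $\mathbb N_0=\{0,1,2,\dots\}$. $(s_j)_{j=0}^{2n+1}$ is a sequence of complex $p\times q$ matrices. $A^\dagger$ is the Moore–Penrose inverse (for a scalar $c$: $c^\dagger=c^{-1}$ if $c\ne0$ and $0^\dagger=0$), $\mathcal N(A)$ the null space, $\mathcal R(A)$ the column space, $A^*$ the conjugate transpose. First term domination. $\mathcal D_{p\times q,m}$: all sequences $(s_j)_{j=0}^m$ of complex $p\times q$ matrices with $\mathcal N(s_0)\subseteq\mathcal N(s_j)$ and $\mathcal R(s_j)\subseteq\mathcal R(s_0)$ for $0\le j\le m$. For $m\ge1$, $\tilde{\mathcal D}_{p\times q,m}$: all $(s_j)_{j=0}^m$ with $(s_j)_{j=0}^{m-1}\in\mathcal D_{p\times q,m-1}$. Transforms. The $[+,\alpha]$-transform of $(s_j)$ is $(u_j)$ with $u_j=-\alpha s_{j-1}+s_j$, where $s_{-1}=0$. The reciprocal sequence of $(u_j)$ is given by $u_0^\sharp=u_0^\dagger$ and $u_j^\sharp=-u_0^\dagger\sum_{l=0}^{j-1}u_{j-l}u_l^\sharp$ for $j\ge1$ (complex $q\times p$ matrices). Put $s_j^{\sharp,\alpha}=u_j^\sharp$ where $(u_j)$ is the $[+,\alpha]$-transform of $(s_j)$. Also $s_{\alpha,j}=-\alpha s_j+s_{j+1}$. Block matrices. $K_n^{[+,\alpha]}=[u_{j+k+1}]_{j,k=0}^n$, $K_n^{\sharp,\alpha}=[s_{j+k+1}^{\sharp,\alpha}]_{j,k=0}^n$,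 $H_{\alpha,n}=[s_{\alpha,j+k}]_{j,k=0}^n$. For any sequence $(x_j)$, let $S_n(x)$ be the block lower triangular Toeplitz matrix with $(j,k)$ block $x_{j-k}$ for $j\ge k$ and $0$ for $j<k$, and let $\mathbb S_n(x)$ be the block upper triangular Toeplitz matrix with $(j,k)$ block $x_{k-j}$ for $k\ge j$ and $0$ for $k<j$ ($0\le j,k\le n$). Then $S_n=S_n(s)$, $\mathbb S_n=\mathbb S_n(s)$; $S_n^{[+,\alpha]}=S_n(u)$, $\mathbb S_n^{[+,\alpha]}=\mathbb S_n(u)$ with $(u_j)$ the $[+,\alpha]$-transform of $(s_j)$; and $S_n^{\sharp,\alpha},\mathbb S_n^{\sharp,\alpha}$ are $S_n(x),\mathbb S_n(x)$ for $x_j=s_j^{\sharp,\alpha}$. Further, $R_{q,n}(z)=(I_{(n+1)q}-zT_{q,n})^{-1}$ for $z\in\mathbb C$, where $T_{q,n}=[\delta_{j,k+1}I_q]_{j,k=0}^n$; i.e. $R_{q,n}(z)$ is block lower triangular with $(j,k)$ block $z^{j-k}I_q$ for $j\ge k$; $R_{p,n}$ is the same with $p$ in place of $q$. Finally, $\Xi_{n,m}$ is the $(n+1)p\times(n+1)q$ block matrix (with $p\times q$ blocks) all of whose blocks are zero except the lower right corner block, which equals $s_m-s_0s_0^\dagger s_ms_0^\dagger s_0$. *)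

theory Defs
  imports
    "Jordan_Normal_Form.Schur_Decomposition"
    "Jordan_Normal_Form.Matrix_Kernel"
    "Jordan_Normal_Form.Gauss_Jordan_Elimination"
    "Jordan_Normal_Form.DL_Rank"
begin

text \<open>
  A finite sequence \<open>s\<^sub>0, \<dots>, s\<^sub>m\<close> of complex \<open>p \<times> q\<close> matrices is a function \<open>nat \<Rightarrow> complex mat\<close>
  of which only the values at arguments \<open>\<le> m\<close> matter.
\<close>

section \<open>Moore--Penrose inverse\<close>

definition is_pinv :: "complex mat \<Rightarrow> complex mat \<Rightarrow> bool" where
  "is_pinv A X \<longleftrightarrow>
     X \<in> carrier_mat (dim_col A) (dim_row A) \<and>
     A * X * A = A \<and> X * A * X = X \<and>
     mat_adjoint (A * X) = A * X \<and> mat_adjoint (X * A) = X * A"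

text \<open>
  By Penrose's theorem exactly one such \<open>X\<close> exists for every \<open>A\<close>.  For a scalar \<open>c\<close> the
  Moore--Penrose inverse is simply \<open>inverse c\<close>, because \<open>inverse 0 = 0\<close> in HOL.
\<close>

definition pinv :: "complex mat \<Rightarrow> complex mat" where
  "pinv A = (THE X. is_pinv A X)"

section \<open>First term domination\<close>

definition first_term_dominated :: "nat \<Rightarrow> nat \<Rightarrow> nat \<Rightarrow> (nat \<Rightarrow> complex mat) \<Rightarrow> bool" where
  "first_term_dominated p q m s \<longleftrightarrow>
     (\<forall>j\<le>m. s j \<in> carrier_mat p q \<and>
        mat_kernel (s 0) \<subseteq> mat_kernel (s j) \<and>
        vec_space.col_space p (s j) \<subseteq> vec_space.col_space p (s 0))"

text \<open>The class \<open>\<D>\<close> with a tilde; it is only considered for \<open>m \<ge> 1\<close>.\<close>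

definition nearly_first_term_dominated :: "nat \<Rightarrow> nat \<Rightarrow> nat \<Rightarrow> (nat \<Rightarrow> complex mat) \<Rightarrow> bool" where
  "nearly_first_term_dominated p q m s \<longleftrightarrow>
     (\<forall>j\<le>m. s j \<in> carrier_mat p q) \<and> first_term_dominated p q (m - 1) s"

section \<open>Transforms of sequences\<close>

text \<open>The case \<open>j = 0\<close> implements the convention \<open>s\<^sub>-\<^sub>1 = 0\<close>.\<close>

definition plus_transform :: "complex \<Rightarrow> (nat \<Rightarrow> complex mat) \<Rightarrow> nat \<Rightarrow> complex mat" where
  "plus_transform \<alpha> s j =
     (if j = 0 then s 0 else (- \<alpha>) \<cdot>\<^sub>m s (j - 1) + s j)"

text \<open>
  The sum \<open>\<Sum>l<j. u (j - l) * u\<^sup>\<sharp> l\<close> of \<open>p \<times> p\<close> matrices is formed entrywise, since the type of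
  matrices with variable dimensions is not an additive monoid.
\<close>

fun reciprocal :: "(nat \<Rightarrow> complex mat) \<Rightarrow> nat \<Rightarrow> complex mat" where
  "reciprocal u j =
     (if j = 0 then pinv (u 0)
      else - (pinv (u 0) *
        mat (dim_row (u 0)) (dim_row (u 0))
          (\<lambda>ab. \<Sum>l\<in>{..<j}. (u (j - l) * reciprocal u l) $$ ab)))"

declare reciprocal.simps [simp del]

definition sharp :: "complex \<Rightarrow> (nat \<Rightarrow> complex mat) \<Rightarrow> nat \<Rightarrow> complex mat" where
  "sharp \<alpha> s = reciprocal (plus_transform \<alpha> s)"

definition shift_transform :: "complex \<Rightarrow> (nat \<Rightarrow> complex mat) \<Rightarrow> nat \<Rightarrow> complex mat" where
  "shift_transform \<alpha> s j = (- \<alpha>) \<cdot>\<^sub>m s j + s (j + 1)"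

section \<open>Block matrices\<close>

text \<open>\<open>block_mat n p q F\<close> is \<open>[F j k]\<close>, \<open>0 \<le> j, k \<le> n\<close>, with blocks \<open>F j k\<close> of size \<open>p \<times> q\<close>.\<close>

definition block_mat :: "nat \<Rightarrow> nat \<Rightarrow> nat \<Rightarrow> (nat \<Rightarrow> nat \<Rightarrow> complex mat) \<Rightarrow> complex mat" where
  "block_mat n p q F = mat ((n + 1) * p) ((n + 1) * q)
     (\<lambda>(a, b). F (a div p) (b div q) $$ (a mod p, b mod q))"

definition hankel :: "nat \<Rightarrow> nat \<Rightarrow> nat \<Rightarrow> (nat \<Rightarrow> complex mat) \<Rightarrow> complex mat" where
  "hankel p q n x = block_mat n p q (\<lambda>j k. x (j + k))"

definition lower_toeplitz :: "nat \<Rightarrow> nat \<Rightarrow> nat \<Rightarrow> (nat \<Rightarrow> complex mat) \<Rightarrow> complex mat" where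
  "lower_toeplitz p q n x = block_mat n p q (\<lambda>j k. if k \<le> j then x (j - k) else 0\<^sub>m p q)"

definition upper_toeplitz :: "nat \<Rightarrow> nat \<Rightarrow> nat \<Rightarrow> (nat \<Rightarrow> complex mat) \<Rightarrow> complex mat" where
  "upper_toeplitz p q n x = block_mat n p q (\<lambda>j k. if j \<le> k then x (k - j) else 0\<^sub>m p q)"

text \<open>
  In the following names \<open>plus\<close> stands for the superscript \<open>[+,\<alpha>]\<close>, \<open>sharp\<close> for \<open>\<sharp>,\<alpha>\<close>, and
  \<open>SS\<close> for the blackboard-bold (upper triangular) \<open>S\<close>.  The matrices of a sharp sequence consist of
  \<open>q \<times> p\<close> blocks.
\<close>

definition K_plus :: "nat \<Rightarrow> nat \<Rightarrow> complex \<Rightarrow> nat \<Rightarrow> (nat \<Rightarrow> complex mat) \<Rightarrow> complex mat" where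
  "K_plus p q \<alpha> n s = hankel p q n (\<lambda>j. plus_transform \<alpha> s (j + 1))"

definition K_sharp :: "nat \<Rightarrow> nat \<Rightarrow> complex \<Rightarrow> nat \<Rightarrow> (nat \<Rightarrow> complex mat) \<Rightarrow> complex mat" where
  "K_sharp p q \<alpha> n s = hankel q p n (\<lambda>j. sharp \<alpha> s (j + 1))"

definition H_shift :: "nat \<Rightarrow> nat \<Rightarrow> complex \<Rightarrow> nat \<Rightarrow> (nat \<Rightarrow> complex mat) \<Rightarrow> complex mat" where
  "H_shift p q \<alpha> n s = hankel p q n (shift_transform \<alpha> s)"

definition S_plus :: "nat \<Rightarrow> nat \<Rightarrow> complex \<Rightarrow> nat \<Rightarrow> (nat \<Rightarrow> complex mat) \<Rightarrow> complex mat" where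
  "S_plus p q \<alpha> n s = lower_toeplitz p q n (plus_transform \<alpha> s)"

definition SS_plus :: "nat \<Rightarrow> nat \<Rightarrow> complex \<Rightarrow> nat \<Rightarrow> (nat \<Rightarrow> complex mat) \<Rightarrow> complex mat" where
  "SS_plus p q \<alpha> n s = upper_toeplitz p q n (plus_transform \<alpha> s)"

definition S_sharp :: "nat \<Rightarrow> nat \<Rightarrow> complex \<Rightarrow> nat \<Rightarrow> (nat \<Rightarrow> complex mat) \<Rightarrow> complex mat" where
  "S_sharp p q \<alpha> n s = lower_toeplitz q p n (sharp \<alpha> s)"

definition SS_sharp :: "nat \<Rightarrow> nat \<Rightarrow> complex \<Rightarrow> nat \<Rightarrow> (nat \<Rightarrow> complex mat) \<Rightarrow> complex mat" where
  "SS_sharp p q \<alpha> n s = upper_toeplitz q p n (sharp \<alpha> s)"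

definition Xi :: "nat \<Rightarrow> nat \<Rightarrow> nat \<Rightarrow> nat \<Rightarrow> (nat \<Rightarrow> complex mat) \<Rightarrow> complex mat" where
  "Xi p q n m s = block_mat n p q (\<lambda>j k.
     if j = n \<and> k = n then s m - s 0 * pinv (s 0) * s m * pinv (s 0) * s 0 else 0\<^sub>m p q)"

definition T_shift :: "nat \<Rightarrow> nat \<Rightarrow> complex mat" where
  "T_shift q n = block_mat n q q (\<lambda>j k. if j = k + 1 then 1\<^sub>m q else 0\<^sub>m q q)"

definition resolvent :: "nat \<Rightarrow> nat \<Rightarrow> complex \<Rightarrow> complex mat" where
  "resolvent q n z = the (mat_inverse (1\<^sub>m ((n + 1) * q) - z \<cdot>\<^sub>m T_shift q n))"

lemma resolvent_blocks:
  assumes q: "q \<ge> 1"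
  shows "resolvent q n z =
    block_mat n q q (\<lambda>j k. if k \<le> j then z ^ (j - k) \<cdot>\<^sub>m 1\<^sub>m q else 0\<^sub>m q q)" (is "_ = ?R")
proof -
  define N where "N = (n + 1) * q"
  let ?A = "1\<^sub>m N - z \<cdot>\<^sub>m T_shift q n"
  have A: "?A \<in> carrier_mat N N" and R: "?R \<in> carrier_mat N N"
    by (auto simp: T_shift_def block_mat_def N_def)
  have dv: "a div q < n + 1" if "a < N" for a
    using that by (simp add: N_def less_mult_imp_div_less)
  have md: "a mod q < q" for a using q by simp
  have E: "block_mat n q q F $$ (a, b) = F (a div q) (b div q) $$ (a mod q, b mod q)"
    if "a < N" "b < N" for a b F
    using that unfolding N_def block_mat_def by (subst index_mat(1)) auto
  have T: "T_shift q n $$ (a, b) = (if a = b + q then 1 else 0)" if ab: "a < N" "b < N" for a b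
  proof -
    have "a = b + q \<longleftrightarrow> a div q = b div q + 1 \<and> a mod q = b mod q"
      using q by (metis Suc_eq_plus1 add_mult_distrib2 div_add_self2 div_mult_mod_eq
          mod_add_self2 not_one_le_zero)
    then show ?thesis using md by (simp add: T_shift_def E[OF ab])
  qed
  have Rab: "?R $$ (a, b) = (if b div q \<le> a div q \<and> a mod q = b mod q
      then z ^ (a div q - b div q) else 0)" if "a < N" "b < N" for a b
    using md by (simp add: E[OF that])
  have mult: "(X * Y) $$ (a, b) = (\<Sum>c<N. X $$ (a, c) * Y $$ (c, b))"
    if "X \<in> carrier_mat N N" "Y \<in> carrier_mat N N" "a < N" "b < N" for X Y :: "complex mat" and a b
    using that by (auto simp: scalar_prod_def atLeast0LessThan)
  have Aab: "?A $$ (a, b) = (if a = b then 1 else 0) - z * (if a = b + q then 1 else 0)"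
    if "a < N" "b < N" for a b
  proof -
    have "T_shift q n \<in> carrier_mat N N" by (simp add: T_shift_def block_mat_def N_def)
    then show ?thesis using that by (auto simp: T[OF that])
  qed
  have "?A * ?R = 1\<^sub>m N"
  proof (rule eq_matI)
    fix a b assume "a < dim_row (1\<^sub>m N :: complex mat)" "b < dim_col (1\<^sub>m N :: complex mat)"
    then have ab: "a < N" "b < N" by auto
    have "(?A * ?R) $$ (a, b) = (\<Sum>c<N. ?A $$ (a, c) * ?R $$ (c, b))"
      by (rule mult[OF A R ab])
    also have "\<dots> = (\<Sum>c<N. (if a = c then ?R $$ (a, b) else 0)
        - (if q \<le> a \<and> c = a - q then z * ?R $$ (a - q, b) else 0))"
      using ab q by (intro sum.cong refl) (auto simp: Aab)
    also have "\<dots> = ?R $$ (a, b) - (if q \<le> a then z * ?R $$ (a - q, b) else 0)"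
      using ab by (cases "q \<le> a") (auto simp: sum_subtractf)
    also have "\<dots> = (1\<^sub>m N :: complex mat) $$ (a, b)"
    proof (cases "q \<le> a")
      case True
      define a' where "a' = a - q"
      have a: "a = a' + q" "a' < N" using True ab by (auto simp: a'_def)
      have d: "a div q = Suc (a' div q)" "a mod q = a' mod q" using a q by auto
      have e: "a = b \<longleftrightarrow> Suc (a' div q) = b div q \<and> a' mod q = b mod q"
        using d by (metis div_mult_mod_eq)
      show ?thesis using True ab a(2) e
        by (auto simp: Rab d a'_def[symmetric] Suc_diff_le le_Suc_eq)
    next
      case False
      then have "a div q = 0" "a mod q = a" by auto
      then show ?thesis using False ab q
        by (auto simp: Rab) (metis add_cancel_right_left div_mult_mod_eq mult_zero_left)
    qed
    finally show "(?A * ?R) $$ (a, b) = (1\<^sub>m N :: complex mat) $$ (a, b)" .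
  qed (use A R in auto)
  note AR = this
  have RA: "?R * ?A = 1\<^sub>m N" using mat_mult_left_right_inverse[OF A R AR] .
  show ?thesis
  proof (cases "mat_inverse ?A")
    case None
    from mat_inverse(1)[OF A None] have "?A \<notin> Units (ring_mat TYPE(complex) N ())" .
    then show ?thesis using A R AR RA unfolding Units_def ring_mat_def by auto
  next
    case (Some B)
    from mat_inverse(2)[OF A Some] have B: "B * ?A = 1\<^sub>m N" "B \<in> carrier_mat N N" by auto
    have "B = B * (?A * ?R)" using AR B by simp
    also have "\<dots> = ?R" using B A R by (simp flip: assoc_mult_mat)
    finally show ?thesis using Some by (simp add: resolvent_def N_def)
  qed
qed

end

theory Submission
  imports Defs
begin

text \<open>
  Write \<open>D\<close> for the Moore--Penrose inverse of \<open>s\<^sub>0\<close>, and \<open>P = s\<^sub>0 D\<close>, \<open>Q = D s\<^sub>0\<close> for the orthogonal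
  projections onto the column space of \<open>s\<^sub>0\<close> and onto the orthogonal complement of its null space.
  First term domination means \<open>P s\<^sub>j = s\<^sub>j = s\<^sub>j Q\<close>, so a dominated sequence is a formal power series
  whose coefficients map the range of \<open>Q\<close> to the range of \<open>P\<close>, and between these spaces \<open>s\<^sub>0\<close> is invertible with
  inverse \<open>D\<close>.  Hence the reciprocal sequence is a two-sided inverse power series, and all four parts
  are consequences of this.

  Suppose first that the whole sequence is dominated, and let \<open>u\<close> be its \<open>[+,\<alpha>]\<close>-transform and \<open>r\<close> the
  reciprocal of \<open>u\<close>.  Lower Toeplitz matrices multiply like truncated power series, so
  \<open>L\<^sub>u L\<^sub>r = diag P\<close> and \<open>L\<^sub>r L\<^sub>u = diag Q\<close>, and \<open>L\<^sub>r\<close> is the Moore--Penrose inverse of \<open>L\<^sub>u\<close>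
  (\<open>is_pinv_lower_toeplitz\<close>).  A Toeplitz matrix of doubled size consists of two diagonal quarters \<open>L\<^sub>x\<close>
  and one lower left quarter \<open>G\<^sub>x\<close>; the lower left quarter of the product of the two doubled matrices
  says \<open>L\<^sub>u G\<^sub>r + G\<^sub>u L\<^sub>r = 0\<close>, whence \<open>G\<^sub>r = - L\<^sub>r G\<^sub>u L\<^sub>r\<close> and \<open>G\<^sub>u = - L\<^sub>u G\<^sub>r L\<^sub>u\<close>.
  Reversing the order of the block columns turns \<open>G\<^sub>x\<close> into the Hankel matrix of the shifted sequence,
  and reversing block rows and block columns turns a lower Toeplitz matrix into an upper one; this gives
  the first formula of (a) and formula (b), see \<open>hankel_reciprocal\<close>.

  In power series, \<open>u = (1 - \<alpha> z) s\<close>, so \<open>r\<close> is the product of the geometric series and the reciprocal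
  of \<open>s\<close>, the geometric series being the resolvent.  Since \<open>s\<^sub>\<alpha>\<^sub>,\<^sub>j = u\<^sub>j\<^sub>+\<^sub>1\<close>, the second formula of (a) is the
  first one after this factorization.  Parts (a) and (b) express each of the two Hankel matrices as a
  two-sided product around the other, so they have the same rank, and (d) follows from (a) because
  the determinant of a Toeplitz matrix is a power of the determinant of its first entry, and
  \<open>det D\<close> is the inverse of \<open>det s\<^sub>0\<close>, with the convention that the inverse of 0 is 0.

  In general the last term \<open>s\<^sub>m\<close>, \<open>m = 2n+1\<close>, is arbitrary.  Replacing it by \<open>P s\<^sub>m Q\<close> makes the sequence
  dominated.  It does not change \<open>r\<close>, since \<open>u\<^sub>m\<close> enters \<open>r\<^sub>m\<close> only through \<open>D u\<^sub>m D\<close>, and it changes the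
  Hankel matrix of \<open>u\<close> exactly by the correction \<open>\<Xi>\<close> (\<open>Xi\<close>), which disappears between the Toeplitz matrices in (a)
  because \<open>P (s\<^sub>m - P s\<^sub>m Q) Q = 0\<close>.
\<close>

section \<open>Adjoint matrices\<close>

lemma adjoint_dims [simp]:
  "dim_row (mat_adjoint A) = dim_col A" "dim_col (mat_adjoint A) = dim_row A"
  by (simp_all add: mat_adjoint_def)

lemma adjoint_carrier [simp]:
  "A \<in> carrier_mat n m \<Longrightarrow> mat_adjoint A \<in> carrier_mat m n"
  by (intro carrier_matI) auto

lemma index_adjoint [simp]:
  fixes A :: "complex mat"
  assumes "i < dim_col A" "j < dim_row A"
  shows "mat_adjoint A $$ (i, j) = cnj (A $$ (j, i))"
  using assms by (simp add: mat_adjoint_def mat_of_rows_def)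

lemma adjoint_adjoint [simp]: "mat_adjoint (mat_adjoint A) = (A :: complex mat)"
  by (rule eq_matI) auto

lemma adjoint_zero [simp]: "mat_adjoint (0\<^sub>m p q :: complex mat) = 0\<^sub>m q p"
  by (rule eq_matI) auto

lemma adjoint_one [simp]: "mat_adjoint (1\<^sub>m p :: complex mat) = 1\<^sub>m p"
  by (rule eq_matI) auto

lemma adjoint_mult:
  fixes A B :: "complex mat"
  assumes "A \<in> carrier_mat n m" "B \<in> carrier_mat m k"
  shows "mat_adjoint (A * B) = mat_adjoint B * mat_adjoint A"
proof (rule eq_matI)
  fix i j assume "i < dim_row (mat_adjoint B * mat_adjoint A)"
    "j < dim_col (mat_adjoint B * mat_adjoint A)"
  then show "mat_adjoint (A * B) $$ (i, j) = (mat_adjoint B * mat_adjoint A) $$ (i, j)"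
    using assms by (auto simp: scalar_prod_def mult.commute intro!: sum.cong)
qed (use assms in auto)

section \<open>Rank factorization\<close>

lemma mat_mult_unit_vec:
  fixes A :: "complex mat"
  assumes "A \<in> carrier_mat n m" "j < m"
  shows "A *\<^sub>v unit_vec m j = col A j"
  using assms by (intro eq_vecI) (auto simp: scalar_prod_right_unit)

text \<open>
  The columns of \<open>B\<close> are a maximal independent set of columns of \<open>A\<close>.  The matrix \<open>E\<close> selects them from \<open>A\<close>;
  it lets a left inverse of \<open>B\<close> be turned into a generalized inverse of \<open>A\<close>.
\<close>
lemma rank_factorization:
  fixes A :: "complex mat"
  assumes A: "A \<in> carrier_mat n m"
  obtains B C E where
    "B \<in> carrier_mat n (vec_space.rank n A)" "C \<in> carrier_mat (vec_space.rank n A) m"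
    "E \<in> carrier_mat m (vec_space.rank n A)" "A = B * C" "B = A * E"
    "\<And>v. v \<in> carrier_vec (vec_space.rank n A) \<Longrightarrow> B *\<^sub>v v = 0\<^sub>v n \<Longrightarrow> v = 0\<^sub>v (vec_space.rank n A)"
proof -
  interpret vec_space "TYPE(complex)" n .
  let ?P = "\<lambda>T. T \<subseteq> set (cols A) \<and> lin_indpt T"
  have colsA: "set (cols A) \<subseteq> carrier_vec n" using A cols_dim by blast
  have "lin_indpt {}"
    using unit_vecs_basis subset_li_is_li[of "set (unit_vecs n)" "{}"] by (auto simp: basis_def)
  then obtain S where S: "finite S" "maximal S ?P"
    using maximal_exists_superset[of "set (cols A)" ?P "{}"] by auto
  have S': "S \<subseteq> set (cols A)" "lin_indpt S" using S(2) by (auto simp: maximal_def)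
  then have SC: "S \<subseteq> carrier_vec n" using colsA by auto
  have rk: "rank A = card S" by (rule rank_card_indpt[OF A S(2)])
  obtain ws where ws: "set ws = S" "distinct ws" using finite_distinct_list[OF S(1)] by auto
  define k where "k = rank A"
  have len: "length ws = k" using ws rk distinct_card k_def by metis
  define B where "B = mat_of_cols n ws"
  have B: "B \<in> carrier_mat n k" by (simp add: B_def len mat_of_cols_def)
  have colsB: "cols B = ws" unfolding B_def using SC ws by (intro cols_mat_of_cols) auto
  have inspan: "c \<in> span S" if c: "c \<in> set (cols A)" for c
  proof (rule ccontr)
    assume n: "c \<notin> span S"
    then have "c \<notin> S" using SC span_mem by blast
    have cc: "c \<in> carrier_vec n" using c colsA by auto
    have "lin_indpt (S \<union> {c})"
      using lin_dep_iff_in_span[OF SC S'(2) _ \<open>c \<notin> S\<close>] cc n by auto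
    then have "?P (S \<union> {c})" using S' c by auto
    then show False using S(2) \<open>c \<notin> S\<close> unfolding maximal_def by blast
  qed
  have spanB: "span S = {y \<in> carrier_vec n. \<exists>x\<in>carrier_vec k. B *\<^sub>v x = y}"
    using col_space_eq[OF B] B colsB ws by (simp add: col_space_def)
  have ex1: "\<exists>x\<in>carrier_vec k. B *\<^sub>v x = col A i" if "i < m" for i
    using inspan[of "col A i"] spanB that A by (auto simp: cols_def)
  then obtain f where f: "\<And>i. i < m \<Longrightarrow> f i \<in> carrier_vec k \<and> B *\<^sub>v f i = col A i" by metis
  define C where "C = mat k m (\<lambda>(a, i). f i $ a)"
  have C: "C \<in> carrier_mat k m" by (simp add: C_def)
  have colC: "col C i = f i" if "i < m" for i
    using f[OF that] that by (intro eq_vecI) (auto simp: C_def)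
  have AC: "A = B * C"
  proof (rule mat_col_eqI)
    fix i assume "i < dim_col (B * C)"
    then have i: "i < m" using C by auto
    show "col A i = col (B * C) i"
      using f[OF i] colC[OF i] col_mult2[OF B C i] by simp
  qed (use A B C in auto)
  have ex2: "\<exists>j<m. col B i = col A j" if i: "i < k" for i
  proof -
    have "col B i \<in> set (cols A)" using colsB ws S' i B len
      by (metis carrier_matD(2) cols_nth nth_mem subsetD)
    then show ?thesis using A by (auto simp: cols_def)
  qed
  then obtain g where g: "\<And>i. i < k \<Longrightarrow> g i < m \<and> col B i = col A (g i)" by metis
  define E where "E = mat m k (\<lambda>(a, i). if a = g i then 1 else 0 :: complex)"
  have E: "E \<in> carrier_mat m k" by (simp add: E_def)
  have colE: "col E i = unit_vec m (g i)" if "i < k" for i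
    using g[OF that] that by (intro eq_vecI) (auto simp: E_def unit_vec_def)
  have BE: "B = A * E"
  proof (rule mat_col_eqI)
    fix i assume "i < dim_col (A * E)"
    then have i: "i < k" using E by auto
    show "col B i = col (A * E) i"
      using g[OF i] colE[OF i] col_mult2[OF A E i] mat_mult_unit_vec[OF A] by auto
  qed (use A B E in auto)
  have ker: "v = 0\<^sub>v k" if v: "v \<in> carrier_vec k" "B *\<^sub>v v = 0\<^sub>v n" for v
    using lin_depI[OF B v(1) _ v(2)] colsB ws S'(2) by auto
  show thesis using that[of B C E] B C E AC BE ker unfolding k_def by blast
qed

lemma rank_mult_le_inner_dim:
  fixes B C :: "complex mat"
  assumes B: "B \<in> carrier_mat n k" and C: "C \<in> carrier_mat k m"
  shows "vec_space.rank n (B * C) \<le> k"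
proof -
  interpret vec_space "TYPE(complex)" n .
  have BC: "B * C \<in> carrier_mat n m" using B C by simp
  have cB: "set (cols B) \<subseteq> carrier_vec n" and cBC: "set (cols (B * C)) \<subseteq> carrier_vec n"
    using B BC cols_dim by blast+
  have "col_space (B * C) \<subseteq> col_space B"
  proof
    fix y assume "y \<in> col_space (B * C)"
    then obtain x where x: "x \<in> carrier_vec m" "B * C *\<^sub>v x = y" "y \<in> carrier_vec n"
      using B C unfolding col_space_eq[OF BC] by auto
    then have "B *\<^sub>v (C *\<^sub>v x) = y" "C *\<^sub>v x \<in> carrier_vec k"
      using assoc_mult_mat_vec[OF B C] C by auto
    then show "y \<in> col_space B" using x B unfolding col_space_eq[OF B] by auto
  qed
  then have sub: "span (set (cols (B * C))) \<subseteq> span (set (cols B))"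
    by (simp add: col_space_def)
  have s1: "VectorSpace.subspace class_ring (span (set (cols B))) V"
    and s2: "VectorSpace.subspace class_ring (span (set (cols (B * C)))) V"
    using span_is_subspace cB cBC by auto
  have "rank (B * C) \<le> rank B" unfolding rank_def
    using vectorspace.subspace_dim[OF subspace_is_vs[OF s1] nested_subspaces[OF s1 s2 sub]]
      fin_dim_span_cols[OF B] fin_dim_span_cols[OF BC] by simp
  also have "\<dots> \<le> k" by (rule rank_le_nc[OF B])
  finally show ?thesis .
qed

text \<open>
  The factor \<open>X\<close> may change the ambient space, so the column spaces of the two matrices cannot be compared
  directly.  A rank factorization of \<open>A\<close> yields a factorization of the product with the same inner dimension.
\<close>
lemma rank_mult_both_sides_le:
  fixes A X Y :: "complex mat"
  assumes A: "A \<in> carrier_mat n m" and X: "X \<in> carrier_mat k n" and Y: "Y \<in> carrier_mat m l"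
  shows "vec_space.rank k (X * A * Y) \<le> vec_space.rank n A"
proof -
  obtain B C where B: "B \<in> carrier_mat n (vec_space.rank n A)"
    and C: "C \<in> carrier_mat (vec_space.rank n A) m" and BC: "A = B * C"
    using rank_factorization[OF A] by metis
  have "X * (B * C) * Y = (X * B) * (C * Y)"
    using assoc_mult_mat[OF X B C] assoc_mult_mat[OF mult_carrier_mat[OF X B] C Y] by simp
  then have "X * A * Y = (X * B) * (C * Y)" using BC by simp
  then show ?thesis using rank_mult_le_inner_dim[of "X * B" k _ "C * Y" l] X Y B C by simp
qed

section \<open>The Moore--Penrose inverse\<close>

text \<open>
  Both \<open>A X\<close> and \<open>A Y\<close> are Hermitian and each absorbs the other from the left, so taking adjoints shows
  that they agree; likewise \<open>X A = Y A\<close>.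
\<close>
lemma is_pinv_unique:
  assumes X: "is_pinv A X" and Y: "is_pinv A Y"
  shows "X = Y"
proof -
  define m n where "m = dim_row A" and "n = dim_col A"
  have A: "A \<in> carrier_mat m n" by (simp add: m_def n_def)
  have cX: "X \<in> carrier_mat n m" and cY: "Y \<in> carrier_mat n m"
    using X Y by (auto simp: is_pinv_def m_def n_def)
  have X': "A * X * A = A" "X * A * X = X" "mat_adjoint (A * X) = A * X"
      "mat_adjoint (X * A) = X * A"
    and Y': "A * Y * A = A" "Y * A * Y = Y" "mat_adjoint (A * Y) = A * Y"
      "mat_adjoint (Y * A) = Y * A"
    using X Y by (auto simp: is_pinv_def)
  have cAX: "A * X \<in> carrier_mat m m" and cAY: "A * Y \<in> carrier_mat m m"
    and cXA: "X * A \<in> carrier_mat n n" and cYA: "Y * A \<in> carrier_mat n n"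
    using A cX cY by auto
  have "A * X = A * Y * A * X" by (simp add: Y')
  also have "\<dots> = (A * Y) * (A * X)" by (rule assoc_mult_mat[OF cAY A cX])
  finally have 1: "A * X = (A * Y) * (A * X)" .
  have "A * X = mat_adjoint ((A * Y) * (A * X))" using 1 X'(3) by simp
  also have "\<dots> = (A * X) * (A * Y)" using adjoint_mult[OF cAY cAX] X' Y' by simp
  also have "\<dots> = A * X * A * Y" by (rule assoc_mult_mat[OF cAX A cY, symmetric])
  finally have AX: "A * X = A * Y" by (simp add: X')
  have "X * A = X * (A * Y * A)" by (simp add: Y')
  also have "\<dots> = (X * A) * (Y * A)"
    by (simp add: assoc_mult_mat[OF A cY A] assoc_mult_mat[OF cX A cYA])
  finally have 2: "X * A = (X * A) * (Y * A)" .
  have "X * A = mat_adjoint ((X * A) * (Y * A))" using 2 X'(4) by simp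
  also have "\<dots> = (Y * A) * (X * A)" using adjoint_mult[OF cXA cYA] X' Y' by simp
  also have "\<dots> = Y * (A * X * A)"
    by (simp add: assoc_mult_mat[OF A cX A] assoc_mult_mat[OF cY A cXA])
  finally have XA: "X * A = Y * A" by (simp add: X')
  have "X = Y * A * X" using X'(2) XA by simp
  also have "\<dots> = Y * (A * Y)" by (simp add: assoc_mult_mat[OF cY A cX] AX)
  also have "\<dots> = Y" using Y'(2) by (simp add: assoc_mult_mat[OF cY A cY])
  finally show ?thesis .
qed

lemma pinv_eqI: "is_pinv A X \<Longrightarrow> pinv A = X"
  unfolding pinv_def by (rule the_equality) (auto intro: is_pinv_unique)

lemma adjoint_scalar_prod:
  fixes A :: "complex mat"
  assumes A: "A \<in> carrier_mat n m" and w: "w \<in> carrier_vec n" and v: "v \<in> carrier_vec m"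
  shows "(mat_adjoint A *\<^sub>v w) \<bullet>c v = w \<bullet>c (A *\<^sub>v v)"
proof -
  have "(mat_adjoint A *\<^sub>v w) \<bullet>c v = (\<Sum>i<m. \<Sum>j<n. cnj (A $$ (j, i)) * w $ j * cnj (v $ i))"
    using A w v by (auto simp: scalar_prod_def sum_distrib_right atLeast0LessThan intro!: sum.cong)
  also have "\<dots> = (\<Sum>j<n. \<Sum>i<m. cnj (A $$ (j, i)) * w $ j * cnj (v $ i))"
    by (rule sum.swap)
  also have "\<dots> = w \<bullet>c (A *\<^sub>v v)"
    using A w v by (auto simp: scalar_prod_def sum_distrib_left atLeast0LessThan mult_ac
        intro!: sum.cong)
  finally show ?thesis .
qed

text \<open>
  The Gram matrix of linearly independent columns is invertible, and the left inverse that it provides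
  is such that \<open>B W\<close> is the orthogonal projection onto the column space.
\<close>
lemma gram_left_inverse:
  fixes B :: "complex mat"
  assumes B: "B \<in> carrier_mat n k"
    and ker: "\<And>v. v \<in> carrier_vec k \<Longrightarrow> B *\<^sub>v v = 0\<^sub>v n \<Longrightarrow> v = 0\<^sub>v k"
  obtains W where "W \<in> carrier_mat k n" "W * B = 1\<^sub>m k" "mat_adjoint (B * W) = B * W"
proof -
  define H where "H = mat_adjoint B * B"
  have B': "mat_adjoint B \<in> carrier_mat k n" using B by simp
  have H: "H \<in> carrier_mat k k" unfolding H_def by (rule mult_carrier_mat[OF B' B])
  have "v = 0\<^sub>v k" if v: "v \<in> carrier_vec k" "H *\<^sub>v v = 0\<^sub>v k" for v
  proof -
    have Bv: "B *\<^sub>v v \<in> carrier_vec n" using B v by simp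
    have "(B *\<^sub>v v) \<bullet>c (B *\<^sub>v v) = (H *\<^sub>v v) \<bullet>c v"
      using adjoint_scalar_prod[OF B Bv v(1)] assoc_mult_mat_vec[OF B' B v(1)] by (simp add: H_def)
    also have "\<dots> = 0" using v by simp
    finally show ?thesis using ker[OF v(1)] Bv by simp
  qed
  then have "det H \<noteq> 0" using det_0_iff_vec_prod_zero_field[OF H] by blast
  then obtain G where G: "G \<in> carrier_mat k k" "G * H = 1\<^sub>m k" "H * G = 1\<^sub>m k"
    using det_non_zero_imp_unit[OF H, of "()"] unfolding Units_def ring_mat_def by auto
  have Hsa: "mat_adjoint H = H" using adjoint_mult[OF B' B] by (simp add: H_def)
  have G': "mat_adjoint G \<in> carrier_mat k k" using G by simp
  have "H * mat_adjoint G = 1\<^sub>m k"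
    using adjoint_mult[OF G(1) H] Hsa G(2) by simp
  then have "G * (H * mat_adjoint G) = G" using G by simp
  then have Gsa: "mat_adjoint G = G"
    using assoc_mult_mat[OF G(1) H G'] G(2) left_mult_one_mat[OF G'] by simp
  define W where "W = G * mat_adjoint B"
  have W: "W \<in> carrier_mat k n" using G B by (simp add: W_def)
  have "W * B = 1\<^sub>m k" using assoc_mult_mat[OF G(1) B' B] G(2) by (simp add: W_def H_def)
  moreover have "mat_adjoint (B * W) = B * W"
    using adjoint_mult[OF B W] adjoint_mult[OF G(1) B'] Gsa assoc_mult_mat[OF B G(1) B']
    by (simp add: W_def)
  ultimately show thesis using that W by blast
qed

text \<open>
  Half of the Penrose equations; the other half comes from applying this to the adjoint.
\<close>
lemma hermitian_range_inverse:
  fixes A :: "complex mat"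
  assumes A: "A \<in> carrier_mat n m"
  obtains X where "X \<in> carrier_mat m n" "A * X * A = A" "mat_adjoint (A * X) = A * X"
proof -
  let ?k = "vec_space.rank n A"
  obtain B C E where f: "B \<in> carrier_mat n ?k" "C \<in> carrier_mat ?k m" "E \<in> carrier_mat m ?k"
    "A = B * C" "B = A * E" "\<And>v. v \<in> carrier_vec ?k \<Longrightarrow> B *\<^sub>v v = 0\<^sub>v n \<Longrightarrow> v = 0\<^sub>v ?k"
    using rank_factorization[OF A] by metis
  obtain W where W: "W \<in> carrier_mat ?k n" "W * B = 1\<^sub>m ?k" "mat_adjoint (B * W) = B * W"
    using gram_left_inverse[OF f(1) f(6)] by metis
  have AX: "A * (E * W) = B * W" using assoc_mult_mat[OF A f(3) W(1)] f(5) by simp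
  have "B * W * A = B * (W * (B * C))"
    using assoc_mult_mat[OF f(1) W(1) A] f(4) by simp
  also have "\<dots> = B * C" using assoc_mult_mat[OF W(1) f(1) f(2)] W(2) f(2) by simp
  finally have "B * W * A = A" using f(4) by simp
  then show thesis using that[of "E * W"] AX W f(3) by simp
qed

text \<open>
  If \<open>A X\<close> is the orthogonal projection onto the column space of \<open>A\<close>, and \<open>Y A\<close> is Hermitian with \<open>A Y A = A\<close>,
  then \<open>Y A X\<close> satisfies all four Penrose equations.
\<close>
lemma is_pinv_pinv: "is_pinv A (pinv A)"
proof -
  define m n where "m = dim_row A" and "n = dim_col A"
  have A: "A \<in> carrier_mat m n" by (simp add: m_def n_def)
  then have A': "mat_adjoint A \<in> carrier_mat n m" by simp
  obtain X where X: "X \<in> carrier_mat n m" "A * X * A = A" "mat_adjoint (A * X) = A * X"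
    using hermitian_range_inverse[OF A] by metis
  obtain Z where Z: "Z \<in> carrier_mat m n" "mat_adjoint A * Z * mat_adjoint A = mat_adjoint A"
    "mat_adjoint (mat_adjoint A * Z) = mat_adjoint A * Z"
    using hermitian_range_inverse[OF A'] by metis
  define Y where "Y = mat_adjoint Z"
  have Y: "Y \<in> carrier_mat n m" using Z by (simp add: Y_def)
  have YA: "Y * A = mat_adjoint A * Z" using adjoint_mult[OF A' Z(1)] Z(3) by (simp add: Y_def)
  have "A = mat_adjoint (mat_adjoint A * Z * mat_adjoint A)" using Z(2) by simp
  also have "\<dots> = A * (mat_adjoint A * Z)"
    using adjoint_mult[of "mat_adjoint A * Z" n n "mat_adjoint A" m] A' Z by simp
  finally have AYA: "A * (Y * A) = A" using YA by simp
  have cYA: "Y * A \<in> carrier_mat n n" and cXA: "X * A \<in> carrier_mat n n" using A X Y by auto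
  define D where "D = Y * A * X"
  have D: "D \<in> carrier_mat n m" using X cYA by (simp add: D_def)
  have AD: "A * D = A * X"
    using assoc_mult_mat[OF A cYA X(1)] AYA by (simp add: D_def)
  have DA: "D * A = Y * A"
    using assoc_mult_mat[OF cYA X(1) A] assoc_mult_mat[OF Y A cXA] X(2)
      assoc_mult_mat[OF A X(1) A] by (simp add: D_def)
  have "D * A * D = D"
    using assoc_mult_mat[OF Y A D] AD assoc_mult_mat[OF Y A X(1)] DA by (simp add: D_def)
  then have "is_pinv A D"
    unfolding is_pinv_def AD DA using D X(2,3) Z(3) YA by (simp add: m_def n_def)
  then show ?thesis using pinv_eqI by metis
qed

lemma pinv_carrier: "A \<in> carrier_mat p q \<Longrightarrow> pinv A \<in> carrier_mat q p"
  using is_pinv_pinv[of A] by (auto simp: is_pinv_def)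

lemma pinv_carrier_dim [simp]: "pinv A \<in> carrier_mat (dim_col A) (dim_row A)"
  using is_pinv_pinv[of A] by (simp add: is_pinv_def)

lemma pinv_dims [simp]: "dim_row (pinv A) = dim_col A" "dim_col (pinv A) = dim_row A"
  using carrier_matD[OF pinv_carrier_dim[of A]] by simp_all

lemma pinv_props:
  "A * pinv A * A = A" "pinv A * A * pinv A = pinv A"
  "mat_adjoint (A * pinv A) = A * pinv A" "mat_adjoint (pinv A * A) = pinv A * A"
  using is_pinv_pinv[of A] by (auto simp: is_pinv_def)

text \<open>
  Taking determinants in \<open>A D A = A\<close> and \<open>D A D = D\<close> leaves the scalar Penrose equations, whose
  solution is the inverse, with value 0 at 0.
\<close>
lemma det_pinv:
  assumes A: "A \<in> carrier_mat n n"
  shows "det (pinv A) = inverse (det A)"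
proof -
  have D: "pinv A \<in> carrier_mat n n" by (rule pinv_carrier[OF A])
  have "det A * det (pinv A) * det A = det A"
    using det_mult[OF mult_carrier_mat[OF A D] A] det_mult[OF A D] by (simp add: pinv_props)
  moreover have "det (pinv A) * det A * det (pinv A) = det (pinv A)"
    using det_mult[OF mult_carrier_mat[OF D A] D] det_mult[OF D A] by (simp add: pinv_props)
  ultimately show ?thesis by (cases "det A = 0") (auto simp: field_simps)
qed

text \<open>
  For Hermitian involutions \<open>U\<close> and \<open>V\<close>; the block reversal below is of this kind.
\<close>
lemma pinv_unitary_equivalent:
  fixes A U V :: "complex mat"
  assumes A: "A \<in> carrier_mat m n" and X: "is_pinv A X"
    and U: "U \<in> carrier_mat m m" "U * U = 1\<^sub>m m" "mat_adjoint U = U"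
    and V: "V \<in> carrier_mat n n" "V * V = 1\<^sub>m n" "mat_adjoint V = V"
  shows "pinv (U * A * V) = V * X * U"
proof -
  have cX: "X \<in> carrier_mat n m" and p: "A * X * A = A" "X * A * X = X"
    "mat_adjoint (A * X) = A * X" "mat_adjoint (X * A) = X * A"
    using X A by (auto simp: is_pinv_def)
  have cancel: "(K * A' * V') * (V' * X' * K') = K * (A' * X') * K'"
    if "K \<in> carrier_mat k k" "A' \<in> carrier_mat k l" "V' \<in> carrier_mat l l" "V' * V' = 1\<^sub>m l"
      "X' \<in> carrier_mat l i" "K' \<in> carrier_mat i i" for K A' V' X' K' :: "complex mat" and k l i
  proof -
    have c: "K * A' \<in> carrier_mat k l" "V' * X' \<in> carrier_mat l i" "A' * X' \<in> carrier_mat k i"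
      "X' * K' \<in> carrier_mat l i" using that by auto
    have "(K * A' * V') * (V' * X' * K') = (K * A') * (V' * (V' * (X' * K')))"
      using assoc_mult_mat[OF that(3,5,6)] assoc_mult_mat[OF c(1) that(3), of "V' * (X' * K')"] that c
      by (metis mult_carrier_mat)
    also have "V' * (V' * (X' * K')) = X' * K'"
      using assoc_mult_mat[OF that(3,3) c(4)] that(4) left_mult_one_mat[OF c(4)] by simp
    also have "(K * A') * (X' * K') = K * (A' * X') * K'"
      using assoc_mult_mat[OF that(1,2) c(4)] assoc_mult_mat[OF that(2,5,6)]
        assoc_mult_mat[OF that(1) c(3) that(6)] by simp
    finally show ?thesis .
  qed
  have AX: "(U * A * V) * (V * X * U) = U * (A * X) * U"
    by (rule cancel[OF U(1) A V(1,2) cX U(1)])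
  have XA: "(V * X * U) * (U * A * V) = V * (X * A) * V"
    by (rule cancel[OF V(1) cX U(1,2) A V(1)])
  have cAX: "A * X \<in> carrier_mat m m" and cXA: "X * A \<in> carrier_mat n n" using A cX by auto
  have 1: "U * (A * X) * U * (U * A * V) = U * (A * X * A) * V"
    by (rule cancel[OF U(1) cAX U(1,2) A V(1)])
  have 2: "V * (X * A) * V * (V * X * U) = V * (X * A * X) * U"
    by (rule cancel[OF V(1) cXA V(1,2) cX U(1)])
  have sa: "mat_adjoint (W * M * W) = W * M * W"
    if "W \<in> carrier_mat k k" "M \<in> carrier_mat k k" "mat_adjoint M = M" "mat_adjoint W = W"
    for W M :: "complex mat" and k
    using adjoint_mult[OF mult_carrier_mat[OF that(1,2)] that(1)] adjoint_mult[OF that(1,2)]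
      assoc_mult_mat[OF that(1,2,1)] that by simp
  have "is_pinv (U * A * V) (V * X * U)"
    unfolding is_pinv_def AX XA 1 2 p(1,2)
    using sa[OF U(1) cAX p(3) U(3)] sa[OF V(1) cXA p(4) V(3)] U(1) V(1) by auto
  then show ?thesis by (rule pinv_eqI)
qed

section \<open>Block matrices\<close>

lemma block_mat_carrier [simp]:
  "block_mat n p q F \<in> carrier_mat ((n + 1) * p) ((n + 1) * q)"
  "block_mat n p q F \<in> carrier_mat (p + n * p) (q + n * q)"
  by (simp_all add: block_mat_def)

lemma block_index_bound:
  assumes "j \<le> (n::nat)" "a < p"
  shows "j * p + a < (n + 1) * p"
proof -
  have "j * p + a < (j + 1) * p" using assms by simp
  also have "\<dots> \<le> (n + 1) * p" using assms by (intro mult_right_mono) auto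
  finally show ?thesis .
qed

lemma block_mat_index:
  assumes "j \<le> n" "k \<le> n" "a < p" "b < q"
  shows "block_mat n p q F $$ (j * p + a, k * q + b) = F j k $$ (a, b)"
  using assms block_index_bound[of j n a p] block_index_bound[of k n b q]
  by (simp add: block_mat_def)

lemma block_index_cases:
  assumes "i < (n + 1) * (p :: nat)"
  obtains j a where "j \<le> n" "a < p" "i = j * p + a"
proof -
  have "p > 0" using assms by (cases p) auto
  moreover have "i div p < n + 1" using assms by (simp add: less_mult_imp_div_less)
  ultimately show thesis using that[of "i div p" "i mod p"] by simp
qed

lemma block_mat_eqI:
  assumes M: "M \<in> carrier_mat ((n + 1) * p) ((n + 1) * q)"
    and "\<And>j k a b. j \<le> n \<Longrightarrow> k \<le> n \<Longrightarrow> a < p \<Longrightarrow> b < q \<Longrightarrow>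
      M $$ (j * p + a, k * q + b) = F j k $$ (a, b)"
  shows "M = block_mat n p q F"
proof (rule eq_matI)
  fix x y assume "x < dim_row (block_mat n p q F)" "y < dim_col (block_mat n p q F)"
  then have "x < (n + 1) * p" "y < (n + 1) * q" by (auto simp: block_mat_def)
  then show "M $$ (x, y) = block_mat n p q F $$ (x, y)"
    by (elim block_index_cases) (simp add: assms(2) block_mat_index)
qed (use M in \<open>auto simp: block_mat_def\<close>)

lemma block_mat_cong:
  assumes "\<And>j k. j \<le> n \<Longrightarrow> k \<le> n \<Longrightarrow> F j k = G j k"
  shows "block_mat n p q F = block_mat n p q G"
  by (rule block_mat_eqI) (simp_all add: block_mat_index assms)

lemma block_mat_inject:
  assumes "block_mat n p q F = block_mat n p q G" "j \<le> n" "k \<le> n"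
    and "F j k \<in> carrier_mat p q" "G j k \<in> carrier_mat p q"
  shows "F j k = G j k"
proof (rule eq_matI)
  fix a b assume "a < dim_row (G j k)" "b < dim_col (G j k)"
  then have "a < p" "b < q" using assms by auto
  then show "F j k $$ (a, b) = G j k $$ (a, b)"
    using block_mat_index[of j n k a p b q F] block_mat_index[of j n k a p b q G] assms by simp
qed (use assms in auto)

lemma sum_block_index:
  "(\<Sum>i<(n + 1) * p. f i) = (\<Sum>j\<le>n. \<Sum>a<p. f (j * p + a :: nat))"
    for f :: "nat \<Rightarrow> 'a :: comm_monoid_add"
proof -
  have "(\<Sum>i<(n + 1) * p. f i) = (\<Sum>j<n + 1. sum f {j * p..<j * p + p})"
    by (rule sum.nat_group[symmetric])
  also have "\<dots> = (\<Sum>j\<le>n. \<Sum>a<p. f (j * p + a))"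
  proof -
    have "sum f {j * p..<j * p + p} = (\<Sum>a<p. f (j * p + a))" for j
      using sum.shift_bounds_nat_ivl[of f 0 "j * p" p] by (simp add: atLeast0LessThan add.commute)
    then show ?thesis by (simp flip: lessThan_Suc_atMost)
  qed
  finally show ?thesis .
qed

lemma mat_mult_index:
  fixes A B :: "complex mat"
  assumes "A \<in> carrier_mat p q" "B \<in> carrier_mat q r" "a < p" "b < r"
  shows "(A * B) $$ (a, b) = (\<Sum>c<q. A $$ (a, c) * B $$ (c, b))"
  using assms by (auto simp: scalar_prod_def atLeast0LessThan)

text \<open>
  Block multiplication.  The sum of the block products is kept entrywise, because matrices
  of varying dimension do not form an additive monoid.
\<close>
lemma block_mat_mult_index:
  assumes F: "\<And>j k. j \<le> n \<Longrightarrow> k \<le> n \<Longrightarrow> F j k \<in> carrier_mat p q"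
    and G: "\<And>j k. j \<le> n \<Longrightarrow> k \<le> n \<Longrightarrow> G j k \<in> carrier_mat q r"
    and "j \<le> n" "k \<le> n" "a < p" "b < r"
  shows "(block_mat n p q F * block_mat n q r G) $$ (j * p + a, k * r + b)
    = (\<Sum>l\<le>n. (F j l * G l k) $$ (a, b))"
proof -
  have "(block_mat n p q F * block_mat n q r G) $$ (j * p + a, k * r + b)
    = (\<Sum>l\<le>n. \<Sum>c<q. F j l $$ (a, c) * G l k $$ (c, b))"
    unfolding mat_mult_index[OF block_mat_carrier(1) block_mat_carrier(1)
        block_index_bound[OF assms(3,5)] block_index_bound[OF assms(4,6)]] sum_block_index
    using assms by (intro sum.cong refl) (simp add: block_mat_index)
  also have "\<dots> = (\<Sum>l\<le>n. (F j l * G l k) $$ (a, b))"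
    using assms by (intro sum.cong refl mat_mult_index[symmetric]) auto
  finally show ?thesis .
qed

lemma block_mat_mult_eqI:
  assumes "\<And>j k. j \<le> n \<Longrightarrow> k \<le> n \<Longrightarrow> F j k \<in> carrier_mat p q"
    and "\<And>j k. j \<le> n \<Longrightarrow> k \<le> n \<Longrightarrow> G j k \<in> carrier_mat q r"
    and "\<And>j k a b. j \<le> n \<Longrightarrow> k \<le> n \<Longrightarrow> a < p \<Longrightarrow> b < r \<Longrightarrow>
      (\<Sum>l\<le>n. (F j l * G l k) $$ (a, b)) = K j k $$ (a, b)"
  shows "block_mat n p q F * block_mat n q r G = block_mat n p r K"
proof (rule block_mat_eqI[OF mult_carrier_mat[OF block_mat_carrier(1) block_mat_carrier(1)]])
  fix j k a b assume *: "j \<le> n" "k \<le> n" "a < p" "b < r"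
  show "(block_mat n p q F * block_mat n q r G) $$ (j * p + a, k * r + b) = K j k $$ (a, b)"
    using assms(1,2) by (subst block_mat_mult_index) (use * assms(3)[OF *] in auto)
qed

definition block_diag :: "nat \<Rightarrow> nat \<Rightarrow> nat \<Rightarrow> complex mat \<Rightarrow> complex mat" where
  "block_diag n p q A = block_mat n p q (\<lambda>j k. if j = k then A else 0\<^sub>m p q)"

lemma block_diag_carrier [simp]:
  "block_diag n p q A \<in> carrier_mat ((n + 1) * p) ((n + 1) * q)"
  unfolding block_diag_def by (rule block_mat_carrier)

lemma block_diag_mult:
  assumes "A \<in> carrier_mat p q" "\<And>j k. j \<le> n \<Longrightarrow> k \<le> n \<Longrightarrow> F j k \<in> carrier_mat q r"
  shows "block_diag n p q A * block_mat n q r F = block_mat n p r (\<lambda>j k. A * F j k)"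
  unfolding block_diag_def
proof (rule block_mat_mult_eqI)
  fix j k a b assume *: "j \<le> n" "k \<le> n" "a < p" "b < r"
  have "(\<Sum>l\<le>n. ((if j = l then A else 0\<^sub>m p q) * F l k) $$ (a, b))
    = (\<Sum>l\<le>n. if j = l then (A * F j k) $$ (a, b) else 0)"
  proof (intro sum.cong refl)
    fix l assume "l \<in> {..n}"
    then have F: "F l k \<in> carrier_mat q r" using assms * by auto
    show "((if j = l then A else 0\<^sub>m p q) * F l k) $$ (a, b)
      = (if j = l then (A * F j k) $$ (a, b) else 0)"
      using * by (cases "j = l") (simp_all add: left_mult_zero_mat[OF F])
  qed
  then show "(\<Sum>l\<le>n. ((if j = l then A else 0\<^sub>m p q) * F l k) $$ (a, b)) = (A * F j k) $$ (a, b)"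
    using * by simp
qed (use assms in auto)

lemma mult_block_diag:
  assumes "A \<in> carrier_mat q r" "\<And>j k. j \<le> n \<Longrightarrow> k \<le> n \<Longrightarrow> F j k \<in> carrier_mat p q"
  shows "block_mat n p q F * block_diag n q r A = block_mat n p r (\<lambda>j k. F j k * A)"
  unfolding block_diag_def
proof (rule block_mat_mult_eqI)
  fix j k a b assume *: "j \<le> n" "k \<le> n" "a < p" "b < r"
  have "(\<Sum>l\<le>n. (F j l * (if l = k then A else 0\<^sub>m q r)) $$ (a, b))
    = (\<Sum>l\<le>n. if l = k then (F j k * A) $$ (a, b) else 0)"
  proof (intro sum.cong refl)
    fix l assume "l \<in> {..n}"
    then have F: "F j l \<in> carrier_mat p q" using assms * by auto
    show "(F j l * (if l = k then A else 0\<^sub>m q r)) $$ (a, b)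
      = (if l = k then (F j k * A) $$ (a, b) else 0)"
      using * by (cases "l = k") (simp_all add: right_mult_zero_mat[OF F])
  qed
  then show "(\<Sum>l\<le>n. (F j l * (if l = k then A else 0\<^sub>m q r)) $$ (a, b)) = (F j k * A) $$ (a, b)"
    using * by simp
qed (use assms in auto)

lemma block_diag_one: "block_diag n p p (1\<^sub>m p) = 1\<^sub>m ((n + 1) * p)"
proof (unfold block_diag_def, rule block_mat_eqI[symmetric])
  fix j k a b assume *: "j \<le> n" "k \<le> n" "a < p" "b < p"
  have "j * p + a = k * p + b \<longleftrightarrow> j = k \<and> a = b"
  proof
    assume e: "j * p + a = k * p + b"
    have "(j * p + a) div p = j" "(k * p + b) div p = k" "(j * p + a) mod p = a"
      "(k * p + b) mod p = b" using * by auto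
    then show "j = k \<and> a = b" using e by metis
  qed auto
  then show "1\<^sub>m ((n + 1) * p) $$ (j * p + a, k * p + b)
    = (if j = k then 1\<^sub>m p else 0\<^sub>m p p :: complex mat) $$ (a, b)"
    using * block_index_bound[of j n a p] block_index_bound[of k n b p] by auto
qed simp

text \<open>
  The permutation matrix that reverses the order of the blocks.
\<close>
definition block_flip :: "nat \<Rightarrow> nat \<Rightarrow> complex mat" where
  "block_flip n p = block_mat n p p (\<lambda>j k. if j + k = n then 1\<^sub>m p else 0\<^sub>m p p)"

lemma block_flip_carrier [simp]:
  "block_flip n p \<in> carrier_mat ((n + 1) * p) ((n + 1) * p)"
  unfolding block_flip_def by (rule block_mat_carrier)

lemma block_flip_mult:
  assumes F: "\<And>j k. j \<le> n \<Longrightarrow> k \<le> n \<Longrightarrow> F j k \<in> carrier_mat p q"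
  shows "block_flip n p * block_mat n p q F = block_mat n p q (\<lambda>j k. F (n - j) k)"
  unfolding block_flip_def
proof (rule block_mat_mult_eqI)
  fix j k a b assume *: "j \<le> n" "k \<le> n" "a < p" "b < q"
  have "(\<Sum>l\<le>n. ((if j + l = n then 1\<^sub>m p else 0\<^sub>m p p) * F l k) $$ (a, b))
    = (\<Sum>l\<le>n. if l = n - j then F (n - j) k $$ (a, b) else 0)"
  proof (intro sum.cong refl)
    fix l assume "l \<in> {..n}"
    then have F: "F l k \<in> carrier_mat p q" using F * by auto
    show "((if j + l = n then 1\<^sub>m p else 0\<^sub>m p p) * F l k) $$ (a, b)
      = (if l = n - j then F (n - j) k $$ (a, b) else 0)"
      using * left_mult_zero_mat[OF F] left_mult_one_mat[OF F] by (cases "j + l = n") auto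
  qed
  then show "(\<Sum>l\<le>n. ((if j + l = n then 1\<^sub>m p else 0\<^sub>m p p) * F l k) $$ (a, b)) = F (n - j) k $$ (a, b)"
    using * by simp
qed (use assms in auto)

lemma mult_block_flip:
  assumes F: "\<And>j k. j \<le> n \<Longrightarrow> k \<le> n \<Longrightarrow> F j k \<in> carrier_mat p q"
  shows "block_mat n p q F * block_flip n q = block_mat n p q (\<lambda>j k. F j (n - k))"
  unfolding block_flip_def
proof (rule block_mat_mult_eqI)
  fix j k a b assume *: "j \<le> n" "k \<le> n" "a < p" "b < q"
  have "(\<Sum>l\<le>n. (F j l * (if l + k = n then 1\<^sub>m q else 0\<^sub>m q q)) $$ (a, b))
    = (\<Sum>l\<le>n. if l = n - k then F j (n - k) $$ (a, b) else 0)"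
  proof (intro sum.cong refl)
    fix l assume "l \<in> {..n}"
    then have F: "F j l \<in> carrier_mat p q" using F * by auto
    show "(F j l * (if l + k = n then 1\<^sub>m q else 0\<^sub>m q q)) $$ (a, b)
      = (if l = n - k then F j (n - k) $$ (a, b) else 0)"
      using * right_mult_zero_mat[OF F] right_mult_one_mat[OF F] by (cases "l + k = n") auto
  qed
  then show "(\<Sum>l\<le>n. (F j l * (if l + k = n then 1\<^sub>m q else 0\<^sub>m q q)) $$ (a, b)) = F j (n - k) $$ (a, b)"
    using * by simp
qed (use assms in auto)

lemma block_flip_involution: "block_flip n p * block_flip n p = 1\<^sub>m ((n + 1) * p)"
proof -
  have "block_flip n p * block_flip n p
      = block_mat n p p (\<lambda>j k. if n - j + k = n then 1\<^sub>m p else 0\<^sub>m p p)"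
    using block_flip_mult[of n "\<lambda>j k. if j + k = n then 1\<^sub>m p else 0\<^sub>m p p" p p]
    by (simp add: block_flip_def)
  also have "\<dots> = block_diag n p p (1\<^sub>m p)"
    unfolding block_diag_def by (rule block_mat_cong) auto
  finally show ?thesis by (simp add: block_diag_one)
qed

lemma block_mat_adjoint:
  assumes "\<And>j k. j \<le> n \<Longrightarrow> k \<le> n \<Longrightarrow> F j k \<in> carrier_mat p q"
  shows "mat_adjoint (block_mat n p q F) = block_mat n q p (\<lambda>j k. mat_adjoint (F k j))"
proof (rule block_mat_eqI)
  fix j k a b assume *: "j \<le> n" "k \<le> n" "a < q" "b < p"
  have F: "F k j \<in> carrier_mat p q" using assms * by blast
  have c: "dim_row (block_mat n p q F) = (n + 1) * p" "dim_col (block_mat n p q F) = (n + 1) * q"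
    by (simp_all add: block_mat_def)
  show "mat_adjoint (block_mat n p q F) $$ (j * q + a, k * p + b) = mat_adjoint (F k j) $$ (a, b)"
    using * block_index_bound[of j n a q] block_index_bound[of k n b p] c F
    by (simp add: block_mat_index)
qed simp

lemma adjoint_block_flip: "mat_adjoint (block_flip n p) = block_flip n p"
  unfolding block_flip_def by (subst block_mat_adjoint) (auto intro!: block_mat_cong simp: add.commute)

lemma adjoint_block_diag:
  assumes "A \<in> carrier_mat p q"
  shows "mat_adjoint (block_diag n p q A) = block_diag n q p (mat_adjoint A)"
  unfolding block_diag_def using assms by (subst block_mat_adjoint) (auto intro!: block_mat_cong)

section \<open>Toeplitz and Hankel matrices\<close>

text \<open>
  The coefficients of the product of the matrix power series \<open>\<Sum> x\<^sub>j z\<^sup>j\<close> and \<open>\<Sum> y\<^sub>j z\<^sup>j\<close>.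
\<close>
definition conv :: "nat \<Rightarrow> nat \<Rightarrow> (nat \<Rightarrow> complex mat) \<Rightarrow> (nat \<Rightarrow> complex mat) \<Rightarrow> nat \<Rightarrow> complex mat"
  where "conv p r x y j = mat p r (\<lambda>ab. \<Sum>l\<le>j. (x (j - l) * y l) $$ ab)"

lemma conv_carrier [simp]: "conv p r x y j \<in> carrier_mat p r"
  by (simp add: conv_def)

lemma lower_toeplitz_carrier [simp]:
  "lower_toeplitz p q n x \<in> carrier_mat ((n + 1) * p) ((n + 1) * q)"
  unfolding lower_toeplitz_def by (rule block_mat_carrier)

lemma upper_toeplitz_carrier [simp]:
  "upper_toeplitz p q n x \<in> carrier_mat ((n + 1) * p) ((n + 1) * q)"
  unfolding upper_toeplitz_def by (rule block_mat_carrier)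

lemma lower_toeplitz_cong:
  assumes "\<And>j. j \<le> n \<Longrightarrow> x j = y j"
  shows "lower_toeplitz p q n x = lower_toeplitz p q n y"
  unfolding lower_toeplitz_def using assms by (intro block_mat_cong) auto

lemma lower_toeplitz_inject:
  assumes "lower_toeplitz p q n x = lower_toeplitz p q n y" "j \<le> n"
    and "x j \<in> carrier_mat p q" "y j \<in> carrier_mat p q"
  shows "x j = y j"
  using block_mat_inject[OF assms(1)[unfolded lower_toeplitz_def], of j 0] assms by simp

lemma block_diag_eq_toeplitz:
  "block_diag n p q A = lower_toeplitz p q n (\<lambda>j. if j = 0 then A else 0\<^sub>m p q)"
  unfolding block_diag_def lower_toeplitz_def by (rule block_mat_cong) auto

lemma lower_toeplitz_mult:
  assumes x: "\<And>j. x j \<in> carrier_mat p q" and y: "\<And>j. y j \<in> carrier_mat q r"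
  shows "lower_toeplitz p q n x * lower_toeplitz q r n y = lower_toeplitz p r n (conv p r x y)"
  unfolding lower_toeplitz_def
proof (rule block_mat_mult_eqI)
  fix j k a b assume *: "j \<le> n" "k \<le> n" "a < p" "b < r"
  let ?L = "\<lambda>l. ((if l \<le> j then x (j - l) else 0\<^sub>m p q) * (if k \<le> l then y (l - k) else 0\<^sub>m q r))"
  have zero: "?L l $$ (a, b) = 0" if "\<not> (k \<le> l \<and> l \<le> j)" for l
    using that * x y left_mult_zero_mat[OF y] right_mult_zero_mat[OF x] by auto
  show "(\<Sum>l\<le>n. ?L l $$ (a, b)) = (if k \<le> j then conv p r x y (j - k) else 0\<^sub>m p r) $$ (a, b)"
  proof (cases "k \<le> j")
    case True
    have "(\<Sum>l\<le>n. ?L l $$ (a, b)) = (\<Sum>l\<in>{k..j}. ?L l $$ (a, b))"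
      using * by (intro sum.mono_neutral_right ballI zero) auto
    also have "\<dots> = (\<Sum>l\<le>j - k. ?L (l + k) $$ (a, b))"
      using True by (intro sum.reindex_bij_witness[of _ "\<lambda>l. l + k" "\<lambda>l. l - k"]) auto
    also have "\<dots> = conv p r x y (j - k) $$ (a, b)"
      using * True by (auto simp: conv_def add.commute intro!: sum.cong)
    finally show ?thesis using True by simp
  next
    case False
    then show ?thesis using * zero by (simp del: index_mult_mat)
  qed
qed (use x y in auto)

text \<open>
  The lower left quarter of the lower Toeplitz matrix of doubled size \<open>2n+2\<close>.
\<close>
definition corner :: "nat \<Rightarrow> nat \<Rightarrow> nat \<Rightarrow> (nat \<Rightarrow> complex mat) \<Rightarrow> complex mat" where
  "corner p q n x = block_mat n p q (\<lambda>j k. x (n + 1 + j - k))"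

lemma corner_carrier [simp]: "corner p q n x \<in> carrier_mat ((n + 1) * p) ((n + 1) * q)"
  unfolding corner_def by (rule block_mat_carrier)

text \<open>
  The lower left quarter of a product of two lower Toeplitz matrices of doubled size.  Its block \<open>(j, k)\<close> is
  the coefficient with index \<open>n+1+j-k\<close>, whose sum is split at the middle block column.
\<close>
lemma corner_conv:
  assumes x: "\<And>j. x j \<in> carrier_mat p q" and y: "\<And>j. y j \<in> carrier_mat q r"
  shows "lower_toeplitz p q n x * corner q r n y + corner p q n x * lower_toeplitz q r n y
    = corner p r n (conv p r x y)" (is "?A * ?B + ?C * ?D = _")
  unfolding corner_def[of p r]
proof (rule block_mat_eqI)
  have AB: "?A * ?B \<in> carrier_mat ((n + 1) * p) ((n + 1) * r)"
    by (rule mult_carrier_mat[OF lower_toeplitz_carrier corner_carrier])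
  have CD: "?C * ?D \<in> carrier_mat ((n + 1) * p) ((n + 1) * r)"
    by (rule mult_carrier_mat[OF corner_carrier lower_toeplitz_carrier])
  show "?A * ?B + ?C * ?D \<in> carrier_mat ((n + 1) * p) ((n + 1) * r)" using AB CD by simp
  fix j k a b assume *: "j \<le> n" "k \<le> n" "a < p" "b < r"
  let ?N = "n + 1 + j - k"
  let ?f = "\<lambda>m. (x (?N - m) * y m) $$ (a, b)"
  have 1: "(?A * ?B) $$ (j * p + a, k * r + b)
      = (\<Sum>l\<le>n. ((if l \<le> j then x (j - l) else 0\<^sub>m p q) * y (n + 1 + l - k)) $$ (a, b))"
    unfolding lower_toeplitz_def corner_def using x y *
    by (intro block_mat_mult_index) auto
  also have "\<dots> = (\<Sum>l\<le>j. (x (j - l) * y (n + 1 + l - k)) $$ (a, b))"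
    using * left_mult_zero_mat[OF y] by (intro sum.mono_neutral_cong_right) auto
  also have "\<dots> = (\<Sum>m\<in>{n + 1 - k..?N}. ?f m)"
    using * by (intro sum.reindex_bij_witness[of _ "\<lambda>m. m + k - (n + 1)" "\<lambda>l. n + 1 + l - k"])
      (auto simp: algebra_simps)
  finally have 1: "(?A * ?B) $$ (j * p + a, k * r + b) = (\<Sum>m\<in>{n + 1 - k..?N}. ?f m)" .
  have 2: "(?C * ?D) $$ (j * p + a, k * r + b)
      = (\<Sum>l\<le>n. (x (n + 1 + j - l) * (if k \<le> l then y (l - k) else 0\<^sub>m q r)) $$ (a, b))"
    unfolding lower_toeplitz_def corner_def using x y *
    by (intro block_mat_mult_index) auto
  also have "\<dots> = (\<Sum>l\<in>{k..n}. (x (n + 1 + j - l) * y (l - k)) $$ (a, b))"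
    using * right_mult_zero_mat[OF x] by (intro sum.mono_neutral_cong_right) auto
  also have "\<dots> = (\<Sum>m\<in>{..<n + 1 - k}. ?f m)"
    using * by (intro sum.reindex_bij_witness[of _ "\<lambda>m. m + k" "\<lambda>l. l - k"])
      (auto simp: algebra_simps)
  finally have 2: "(?C * ?D) $$ (j * p + a, k * r + b) = (\<Sum>m\<in>{..<n + 1 - k}. ?f m)" .
  have "(\<Sum>m\<in>{..<n + 1 - k}. ?f m) + (\<Sum>m\<in>{n + 1 - k..?N}. ?f m) = (\<Sum>m\<le>?N. ?f m)"
    using * by (subst sum.union_disjoint[symmetric]) (auto intro!: sum.cong)
  then show "(?A * ?B + ?C * ?D) $$ (j * p + a, k * r + b) = conv p r x y ?N $$ (a, b)"
    using 1 2 * AB CD block_index_bound[of j n a p] block_index_bound[of k n b r]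
    by (simp add: conv_def add.commute del: index_mult_mat)
qed

lemma hankel_eq_corner_flip:
  assumes "\<And>j. x j \<in> carrier_mat p q"
  shows "hankel p q n (\<lambda>j. x (j + 1)) = corner p q n x * block_flip n q"
  unfolding hankel_def corner_def
  by (subst mult_block_flip) (auto intro!: block_mat_cong assms simp: algebra_simps)

lemma upper_eq_flip_lower:
  assumes "\<And>j. x j \<in> carrier_mat p q"
  shows "upper_toeplitz p q n x = block_flip n p * lower_toeplitz p q n x * block_flip n q"
proof -
  have "block_flip n p * lower_toeplitz p q n x
      = block_mat n p q (\<lambda>j k. if k \<le> n - j then x (n - j - k) else 0\<^sub>m p q)"
    unfolding lower_toeplitz_def using assms by (subst block_flip_mult) auto
  also have "\<dots> * block_flip n q
      = block_mat n p q (\<lambda>j k. if n - k \<le> n - j then x (n - j - (n - k)) else 0\<^sub>m p q)"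
    using assms by (subst mult_block_flip) auto
  also have "\<dots> = upper_toeplitz p q n x"
    unfolding upper_toeplitz_def
  proof (rule block_mat_cong)
    fix j k assume "j \<le> n" "k \<le> n"
    then have "n - k \<le> n - j \<longleftrightarrow> j \<le> k" "n - j - (n - k) = k - j" by auto
    then show "(if n - k \<le> n - j then x (n - j - (n - k)) else 0\<^sub>m p q)
      = (if j \<le> k then x (k - j) else 0\<^sub>m p q)" by simp
  qed
  finally show ?thesis by simp
qed

text \<open>
  Peel off the first block row and block column.
\<close>
lemma det_lower_toeplitz:
  assumes x: "\<And>j. x j \<in> carrier_mat p p"
  shows "det (lower_toeplitz p p n x) = det (x 0) ^ (n + 1)"
proof (induction n)
  case 0
  have "lower_toeplitz p p 0 x = x 0"
    unfolding lower_toeplitz_def using x[of 0]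
    by (intro block_mat_eqI[symmetric]) auto
  then show ?case by simp
next
  case (Suc n)
  let ?L = "lower_toeplitz p p (Suc n) x"
  let ?C = "mat ((n + 1) * p) p (\<lambda>(i, b). ?L $$ (i + p, b))"
  let ?R = "four_block_mat (x 0) (0\<^sub>m p ((n + 1) * p)) ?C (lower_toeplitz p p n x)"
  have "?R = block_mat (Suc n) p p (\<lambda>j k. if k \<le> j then x (j - k) else 0\<^sub>m p p)"
  proof (rule block_mat_eqI)
    show "?R \<in> carrier_mat ((Suc n + 1) * p) ((Suc n + 1) * p)"
      using four_block_carrier_mat[OF x[of 0] lower_toeplitz_carrier] by simp
    fix j k a b assume *: "j \<le> Suc n" "k \<le> Suc n" "a < p" "b < p"
    have d: "dim_row (x 0) = p" "dim_col (x 0) = p"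
      "dim_row (lower_toeplitz p p n x) = (n + 1) * p"
      "dim_col (lower_toeplitz p p n x) = (n + 1) * p"
      using x[of 0] lower_toeplitz_carrier[of p p n x] by auto
    have bd: "j * p + a < p + (n + 1) * p" "k * p + b < p + (n + 1) * p"
      using block_index_bound[of j "Suc n" a p] block_index_bound[of k "Suc n" b p] * by auto
    show "?R $$ (j * p + a, k * p + b)
      = (if k \<le> j then x (j - k) else 0\<^sub>m p p) $$ (a, b)"
    proof (cases j)
      case 0
      then show ?thesis using * bd d by (cases k) auto
    next
      case j: (Suc j')
      then have j': "j * p + a = j' * p + a + p" "j' * p + a < (n + 1) * p"
        using * block_index_bound[of j' n a p] by auto
      show ?thesis
      proof (cases k)
        case 0
        then have "?R $$ (j * p + a, k * p + b) = ?L $$ (j * p + a, 0 * p + b)"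
          using * bd d j' by (simp add: add.commute add.left_commute)
        then show ?thesis using 0 * unfolding lower_toeplitz_def
          by (subst (asm) block_mat_index) auto
      next
        case k: (Suc k')
        then have "?R $$ (j * p + a, k * p + b) = lower_toeplitz p p n x $$ (j' * p + a, k' * p + b)"
          using * bd d j j' by simp
        then show ?thesis using j k * unfolding lower_toeplitz_def
          by (subst (asm) block_mat_index) auto
      qed
    qed
  qed
  then have "?L = ?R" by (rule trans[OF lower_toeplitz_def sym])
  then have "det ?L = det ?R" by (rule arg_cong)
  also have "\<dots> = det (x 0) * det (lower_toeplitz p p n x)"
    by (rule det_four_block_mat_upper_right_zero[OF x refl mat_carrier lower_toeplitz_carrier])
  finally show ?case using Suc by simp
qed

lemma det_upper_toeplitz:
  assumes x: "\<And>j. x j \<in> carrier_mat p p"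
  shows "det (upper_toeplitz p p n x) = det (x 0) ^ (n + 1)"
proof -
  have "det (block_flip n p) * det (block_flip n p) = 1"
    using det_mult[OF block_flip_carrier block_flip_carrier, of n p] by (simp add: block_flip_involution)
  moreover have "det (upper_toeplitz p p n x)
      = det (block_flip n p) * det (lower_toeplitz p p n x) * det (block_flip n p)"
    unfolding upper_eq_flip_lower[of x, OF x]
    by (simp only: det_mult[OF mult_carrier_mat[OF block_flip_carrier lower_toeplitz_carrier] block_flip_carrier]
      det_mult[OF block_flip_carrier lower_toeplitz_carrier])
  ultimately show ?thesis by (simp add: det_lower_toeplitz[OF x] mult_ac)
qed

section \<open>Reciprocals of dominated sequences\<close>

text \<open>
  First term domination of an infinite sequence, expressed by the projections onto the column space and
  the row space of the first term: equations are easier to calculate with than inclusions of subspaces.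
\<close>
definition dominated :: "nat \<Rightarrow> nat \<Rightarrow> (nat \<Rightarrow> complex mat) \<Rightarrow> bool" where
  "dominated p q x \<longleftrightarrow> (\<forall>j. x j \<in> carrier_mat p q \<and>
     x 0 * pinv (x 0) * x j = x j \<and> x j * (pinv (x 0) * x 0) = x j)"

lemma dominatedD:
  assumes "dominated p q x"
  shows "x j \<in> carrier_mat p q" "x 0 * pinv (x 0) * x j = x j" "x j * (pinv (x 0) * x 0) = x j"
    "pinv (x 0) \<in> carrier_mat q p" "x 0 * pinv (x 0) \<in> carrier_mat p p"
    "pinv (x 0) * x 0 \<in> carrier_mat q q"
proof -
  show *: "x j \<in> carrier_mat p q" "x 0 * pinv (x 0) * x j = x j"
    "x j * (pinv (x 0) * x 0) = x j" for j
    using assms unfolding dominated_def by blast+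
  show "pinv (x 0) \<in> carrier_mat q p" using *(1)[of 0] by (rule pinv_carrier)
  then show "x 0 * pinv (x 0) \<in> carrier_mat p p" "pinv (x 0) * x 0 \<in> carrier_mat q q"
    using *(1)[of 0] by auto
qed

text \<open>
  The sum in the recursion for the reciprocal sequence.  It omits the term with index \<open>j\<close>
  of the \<open>j\<close>-th convolution coefficient.
\<close>
definition reciprocal_tail :: "(nat \<Rightarrow> complex mat) \<Rightarrow> nat \<Rightarrow> complex mat" where
  "reciprocal_tail u j = mat (dim_row (u 0)) (dim_row (u 0))
     (\<lambda>ab. \<Sum>l\<in>{..<j}. (u (j - l) * reciprocal u l) $$ ab)"

lemma reciprocal_0: "reciprocal u 0 = pinv (u 0)"
  by (simp add: reciprocal.simps)

lemma reciprocal_pos: "j \<noteq> 0 \<Longrightarrow> reciprocal u j = - (pinv (u 0) * reciprocal_tail u j)"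
  by (simp add: reciprocal.simps[of u j] reciprocal_tail_def)

lemma reciprocal_carrier:
  assumes "u 0 \<in> carrier_mat p q"
  shows "reciprocal u j \<in> carrier_mat q p"
proof (cases "j = 0")
  case False
  have "pinv (u 0) * reciprocal_tail u j \<in> carrier_mat q p"
    using pinv_carrier[OF assms] assms by (auto simp: reciprocal_tail_def)
  then show ?thesis using False by (simp add: reciprocal_pos)
qed (use pinv_carrier[OF assms] in \<open>simp add: reciprocal_0\<close>)

lemma mult_entry_sum:
  fixes A :: "complex mat"
  assumes "A \<in> carrier_mat p q" "\<And>l. l \<in> S \<Longrightarrow> M l \<in> carrier_mat q r"
  shows "A * mat q r (\<lambda>ab. \<Sum>l\<in>S. M l $$ ab) = mat p r (\<lambda>ab. \<Sum>l\<in>S. (A * M l) $$ ab)"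
proof (rule eq_matI)
  fix a b assume "a < dim_row (mat p r (\<lambda>ab. \<Sum>l\<in>S. (A * M l) $$ ab))"
    "b < dim_col (mat p r (\<lambda>ab. \<Sum>l\<in>S. (A * M l) $$ ab))"
  then have ab: "a < p" "b < r" by auto
  have "(A * mat q r (\<lambda>ab. \<Sum>l\<in>S. M l $$ ab)) $$ (a, b) = (\<Sum>c<q. \<Sum>l\<in>S. A $$ (a, c) * M l $$ (c, b))"
    using ab by (simp add: mat_mult_index[OF assms(1) mat_carrier] sum_distrib_left)
  also have "\<dots> = (\<Sum>l\<in>S. (A * M l) $$ (a, b))"
    using ab assms by (subst sum.swap) (auto simp: mat_mult_index[OF assms] intro!: sum.cong)
  finally show "(A * mat q r (\<lambda>ab. \<Sum>l\<in>S. M l $$ ab)) $$ (a, b)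
    = mat p r (\<lambda>ab. \<Sum>l\<in>S. (A * M l) $$ ab) $$ (a, b)" using ab by simp
qed (use assms in auto)

lemma entry_sum_mult:
  fixes A :: "complex mat"
  assumes "A \<in> carrier_mat q r" "\<And>l. l \<in> S \<Longrightarrow> M l \<in> carrier_mat p q"
  shows "mat p q (\<lambda>ab. \<Sum>l\<in>S. M l $$ ab) * A = mat p r (\<lambda>ab. \<Sum>l\<in>S. (M l * A) $$ ab)"
proof (rule eq_matI)
  fix a b assume "a < dim_row (mat p r (\<lambda>ab. \<Sum>l\<in>S. (M l * A) $$ ab))"
    "b < dim_col (mat p r (\<lambda>ab. \<Sum>l\<in>S. (M l * A) $$ ab))"
  then have ab: "a < p" "b < r" by auto
  have "(mat p q (\<lambda>ab. \<Sum>l\<in>S. M l $$ ab) * A) $$ (a, b) = (\<Sum>c<q. \<Sum>l\<in>S. M l $$ (a, c) * A $$ (c, b))"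
    using ab by (simp add: mat_mult_index[OF mat_carrier assms(1)] sum_distrib_right)
  also have "\<dots> = (\<Sum>l\<in>S. (M l * A) $$ (a, b))"
    using ab assms by (subst sum.swap) (auto simp: mat_mult_index[OF assms(2,1)] intro!: sum.cong)
  finally show "(mat p q (\<lambda>ab. \<Sum>l\<in>S. M l $$ ab) * A) $$ (a, b)
    = mat p r (\<lambda>ab. \<Sum>l\<in>S. (M l * A) $$ ab) $$ (a, b)" using ab by simp
qed (use assms in auto)

lemma reciprocal_dominated:
  assumes u: "dominated p q u"
  shows "pinv (u 0) * u 0 * reciprocal u j = reciprocal u j"
    and "reciprocal u j * (u 0 * pinv (u 0)) = reciprocal u j"
proof -
  note D = dominatedD[OF u]
  have T: "reciprocal_tail u j \<in> carrier_mat p p" for j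
    using D(1)[of 0] by (simp add: reciprocal_tail_def)
  have DT: "pinv (u 0) * reciprocal_tail u j \<in> carrier_mat q p" for j using D(4) T by auto
  have "pinv (u 0) * u 0 * (pinv (u 0) * M) = pinv (u 0) * M" if "M \<in> carrier_mat p p" for M
    using assoc_mult_mat[OF D(6,4) that] by (simp add: pinv_props)
  then show "pinv (u 0) * u 0 * reciprocal u j = reciprocal u j"
    using T DT D(6)
    by (cases "j = 0") (auto simp: reciprocal_0 pinv_props reciprocal_pos)
  show "reciprocal u j * (u 0 * pinv (u 0)) = reciprocal u j"
  proof (induction j rule: less_induct)
    case (less j)
    have P0: "pinv (u 0) * (u 0 * pinv (u 0)) = pinv (u 0)"
      using assoc_mult_mat[OF D(4) D(1)[of 0] D(4)] by (simp add: pinv_props)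
    show ?case
    proof (cases "j = 0")
      case True
      then show ?thesis using P0 by (simp add: reciprocal_0)
    next
      case False
      note R = reciprocal_carrier[of u, OF D(1)]
      have "reciprocal_tail u j * (u 0 * pinv (u 0)) = reciprocal_tail u j"
      proof -
        have d: "dim_row (u 0) = p" using D(1)[of 0] by auto
        have "reciprocal_tail u j * (u 0 * pinv (u 0))
          = mat p p (\<lambda>ab. \<Sum>l\<in>{..<j}. (u (j - l) * reciprocal u l * (u 0 * pinv (u 0))) $$ ab)"
          unfolding reciprocal_tail_def d
          by (rule entry_sum_mult[OF D(5) mult_carrier_mat[OF D(1) R]])
        also have "\<dots> = reciprocal_tail u j"
          unfolding reciprocal_tail_def d
          using less assoc_mult_mat[OF D(1) R D(5)]
          by (intro cong_mat refl sum.cong arg_cong2[where f = "($$)"]) auto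
        finally show ?thesis .
      qed
      then show ?thesis
        using assoc_mult_mat[OF D(4) T D(5)] carrier_matD[OF DT] carrier_matD[OF D(5)]
        by (simp add: reciprocal_pos[OF False])
    qed
  qed
qed

text \<open>
  For \<open>j > 0\<close> the recursion gives \<open>u\<^sub>0 r\<^sub>j = - P t\<close> with \<open>t\<close> the rest of the convolution sum, and domination
  makes \<open>P t = t\<close>.
\<close>
lemma conv_reciprocal:
  assumes u: "dominated p q u"
  shows "conv p p u (reciprocal u) j = (if j = 0 then u 0 * pinv (u 0) else 0\<^sub>m p p)"
proof (cases "j = 0")
  case True
  have "u 0 * pinv (u 0) \<in> carrier_mat p p" using dominatedD[OF u] by blast
  then show ?thesis using True
    by (auto simp: conv_def reciprocal_0 intro!: eq_matI simp del: index_mult_mat(1))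
next
  case False
  note D = dominatedD[OF u] and R = reciprocal_carrier[of u, OF dominatedD(1)[OF u]]
  have d: "dim_row (u 0) = p" using D(1)[of 0] by auto
  have T: "reciprocal_tail u j \<in> carrier_mat p p" by (simp add: reciprocal_tail_def d)
  have DT: "pinv (u 0) * reciprocal_tail u j \<in> carrier_mat q p" using D(4) T by auto
  have PT: "u 0 * pinv (u 0) * reciprocal_tail u j = reciprocal_tail u j"
  proof -
    have "u 0 * pinv (u 0) * reciprocal_tail u j
      = mat p p (\<lambda>ab. \<Sum>l\<in>{..<j}. (u 0 * pinv (u 0) * (u (j - l) * reciprocal u l)) $$ ab)"
      unfolding reciprocal_tail_def d
      by (rule mult_entry_sum[OF D(5) mult_carrier_mat[OF D(1) R]])
    also have "\<dots> = reciprocal_tail u j"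
      unfolding reciprocal_tail_def d
      using assoc_mult_mat[OF D(5) D(1) R] D(2)
      by (intro cong_mat refl sum.cong arg_cong2[where f = "($$)"]) auto
    finally show ?thesis .
  qed
  have "u 0 * reciprocal u j = - reciprocal_tail u j"
    using False DT D(1)[of 0] assoc_mult_mat[OF D(1)[of 0] D(4) T] PT by (simp add: reciprocal_pos)
  then have "conv p p u (reciprocal u) j = reciprocal_tail u j + - reciprocal_tail u j"
    using T unfolding conv_def
    by (intro eq_matI)
      (auto simp: reciprocal_tail_def d lessThan_Suc_atMost[symmetric] simp del: index_mult_mat(1))
  also have "\<dots> = 0\<^sub>m p p" using T by (intro eq_matI) auto
  finally show ?thesis using False by simp
qed

lemma toeplitz_reciprocal_right:
  assumes u: "dominated p q u"
  shows "lower_toeplitz p q n u * lower_toeplitz q p n (reciprocal u)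
    = block_diag n p p (u 0 * pinv (u 0))"
  unfolding lower_toeplitz_mult[of u, OF dominatedD(1)[OF u] reciprocal_carrier[of u, OF dominatedD(1)[OF u]]]
    block_diag_eq_toeplitz
  by (rule lower_toeplitz_cong) (simp add: conv_reciprocal[OF u])

lemma dominated_toeplitz:
  assumes u: "dominated p q u"
  shows "block_diag n p p (u 0 * pinv (u 0)) * lower_toeplitz p q n u = lower_toeplitz p q n u"
    and "lower_toeplitz p q n u * block_diag n q q (pinv (u 0) * u 0) = lower_toeplitz p q n u"
    and "block_diag n p p (u 0 * pinv (u 0)) * corner p q n u = corner p q n u"
    and "corner p q n u * block_diag n q q (pinv (u 0) * u 0) = corner p q n u"
proof -
  note D = dominatedD[OF u]
  show "block_diag n p p (u 0 * pinv (u 0)) * lower_toeplitz p q n u = lower_toeplitz p q n u"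
    unfolding lower_toeplitz_def
    by (subst block_diag_mult) (use D right_mult_zero_mat[OF D(5)] in \<open>auto intro!: block_mat_cong\<close>)
  show "lower_toeplitz p q n u * block_diag n q q (pinv (u 0) * u 0) = lower_toeplitz p q n u"
    unfolding lower_toeplitz_def
    by (subst mult_block_diag) (use D left_mult_zero_mat[OF D(6)] in \<open>auto intro!: block_mat_cong\<close>)
  show "block_diag n p p (u 0 * pinv (u 0)) * corner p q n u = corner p q n u"
    unfolding corner_def by (subst block_diag_mult) (use D in \<open>auto intro!: block_mat_cong\<close>)
  show "corner p q n u * block_diag n q q (pinv (u 0) * u 0) = corner p q n u"
    unfolding corner_def by (subst mult_block_diag) (use D in \<open>auto intro!: block_mat_cong\<close>)
qed

lemma reciprocal_toeplitz:
  assumes u: "dominated p q u"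
  shows "block_diag n q q (pinv (u 0) * u 0) * lower_toeplitz q p n (reciprocal u)
      = lower_toeplitz q p n (reciprocal u)"
    and "lower_toeplitz q p n (reciprocal u) * block_diag n p p (u 0 * pinv (u 0))
      = lower_toeplitz q p n (reciprocal u)"
    and "block_diag n q q (pinv (u 0) * u 0) * corner q p n (reciprocal u) = corner q p n (reciprocal u)"
proof -
  note D = dominatedD[OF u] and R = reciprocal_carrier[of u, OF dominatedD(1)[OF u]]
    and RD = reciprocal_dominated[OF u]
  show "block_diag n q q (pinv (u 0) * u 0) * lower_toeplitz q p n (reciprocal u)
      = lower_toeplitz q p n (reciprocal u)"
    unfolding lower_toeplitz_def
    by (subst block_diag_mult) (use D(6) R RD right_mult_zero_mat[OF D(6)] in \<open>auto intro!: block_mat_cong\<close>)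
  show "lower_toeplitz q p n (reciprocal u) * block_diag n p p (u 0 * pinv (u 0))
      = lower_toeplitz q p n (reciprocal u)"
    unfolding lower_toeplitz_def
    by (subst mult_block_diag) (use D(5) R RD left_mult_zero_mat[OF D(5)] in \<open>auto intro!: block_mat_cong\<close>)
  show "block_diag n q q (pinv (u 0) * u 0) * corner q p n (reciprocal u) = corner q p n (reciprocal u)"
    unfolding corner_def by (subst block_diag_mult) (use D(6) R RD in \<open>auto intro!: block_mat_cong\<close>)
qed

text \<open>
  That a right inverse is also a left inverse: with \<open>e = r u\<close>, associativity gives \<open>u e = (u r) u = u\<close>.
  Comparing coefficients, \<open>u\<^sub>0 e\<^sub>j = 0\<close> for \<open>j > 0\<close> by induction, and \<open>e\<^sub>j = D u\<^sub>0 e\<^sub>j\<close> because \<open>r\<close> has this property.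
\<close>
lemma conv_reciprocal_left:
  assumes u: "dominated p q u"
  shows "conv q q (reciprocal u) u j = (if j = 0 then pinv (u 0) * u 0 else 0\<^sub>m q q)"
proof (induction j rule: less_induct)
  case (less j)
  note D = dominatedD[OF u] and R = reciprocal_carrier[of u, OF dominatedD(1)[OF u]]
  let ?e = "conv q q (reciprocal u) u"
  show ?case
  proof (cases "j = 0")
    case True
    then show ?thesis using D(4,6) D(1)[of 0]
      by (auto simp: conv_def reciprocal_0 intro!: eq_matI simp del: index_mult_mat(1))
  next
    case False
    have "lower_toeplitz p q j u * lower_toeplitz q q j ?e
      = lower_toeplitz p q j u * lower_toeplitz q p j (reciprocal u) * lower_toeplitz p q j u"
      unfolding assoc_mult_mat[OF lower_toeplitz_carrier lower_toeplitz_carrier lower_toeplitz_carrier]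
        lower_toeplitz_mult[of "reciprocal u", OF R D(1)] ..
    also have "\<dots> = lower_toeplitz p q j u"
      unfolding toeplitz_reciprocal_right[OF u] by (rule dominated_toeplitz[OF u])
    finally have "lower_toeplitz p q j (conv p q u ?e) = lower_toeplitz p q j u"
      unfolding lower_toeplitz_mult[of u, OF D(1) conv_carrier] .
    then have c: "conv p q u ?e j = u j"
      by (rule lower_toeplitz_inject) (use D(1) in auto)
    have e: "?e j \<in> carrier_mat q q" by simp
    have ue: "u 0 * ?e j \<in> carrier_mat p q" using D(1)[of 0] e by auto
    have zero: "u 0 * ?e j = 0\<^sub>m p q"
    proof (rule eq_matI)
      fix a b assume "a < dim_row (0\<^sub>m p q :: complex mat)" "b < dim_col (0\<^sub>m p q :: complex mat)"
      then have ab: "a < p" "b < q" by auto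
      have "u j $$ (a, b) = (\<Sum>l\<le>j. (u (j - l) * ?e l) $$ (a, b))"
        using ab by (subst c[symmetric]) (simp add: conv_def[of p q u])
      also have "\<dots> = (\<Sum>l\<in>{0, j}. (u (j - l) * ?e l) $$ (a, b))"
      proof (rule sum.mono_neutral_right)
        show "\<forall>l\<in>{..j} - {0, j}. (u (j - l) * ?e l) $$ (a, b) = 0"
        proof
          fix l assume "l \<in> {..j} - {0, j}"
          then have "?e l = 0\<^sub>m q q" using less[of l] by auto
          then show "(u (j - l) * ?e l) $$ (a, b) = 0"
            using right_mult_zero_mat[OF D(1)[of "j - l"], of q] ab by simp
        qed
      qed auto
      also have "\<dots> = u j $$ (a, b) + (u 0 * ?e j) $$ (a, b)"
        using False less[of 0] D(3)[of j] by simp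
      finally show "(u 0 * ?e j) $$ (a, b) = 0\<^sub>m p q $$ (a, b)" using ab by simp
    qed (use ue in auto)
    have "pinv (u 0) * u 0 * ?e j = ?e j"
    proof -
      have "pinv (u 0) * u 0 * ?e j
        = mat q q (\<lambda>ab. \<Sum>l\<in>{..j}. (pinv (u 0) * u 0 * (reciprocal u (j - l) * u l)) $$ ab)"
        unfolding conv_def by (rule mult_entry_sum[OF D(6) mult_carrier_mat[OF R D(1)]])
      also have "\<dots> = ?e j"
        unfolding conv_def using assoc_mult_mat[OF D(6) R D(1)] reciprocal_dominated(1)[OF u]
        by (intro cong_mat refl sum.cong arg_cong2[where f = "($$)"]) auto
      finally show ?thesis .
    qed
    then have "?e j = 0\<^sub>m q q"
      using assoc_mult_mat[OF D(4) D(1)[of 0] e] zero right_mult_zero_mat[OF D(4), of q] by simp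
    then show ?thesis using False by simp
  qed
qed

lemma toeplitz_reciprocal_left:
  assumes u: "dominated p q u"
  shows "lower_toeplitz q p n (reciprocal u) * lower_toeplitz p q n u
    = block_diag n q q (pinv (u 0) * u 0)"
  unfolding lower_toeplitz_mult[of "reciprocal u", OF reciprocal_carrier[of u, OF dominatedD(1)[OF u]] dominatedD(1)[OF u]]
    block_diag_eq_toeplitz
  by (rule lower_toeplitz_cong) (simp add: conv_reciprocal_left[OF u])

lemma is_pinv_lower_toeplitz:
  assumes u: "dominated p q u"
  shows "is_pinv (lower_toeplitz p q n u) (lower_toeplitz q p n (reciprocal u))"
proof -
  note D = dominatedD[OF u]
  have "mat_adjoint (block_diag n p p (u 0 * pinv (u 0))) = block_diag n p p (u 0 * pinv (u 0))"
    "mat_adjoint (block_diag n q q (pinv (u 0) * u 0)) = block_diag n q q (pinv (u 0) * u 0)"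
    by (simp_all add: adjoint_block_diag[OF D(5)] adjoint_block_diag[OF D(6)] pinv_props)
  moreover have "lower_toeplitz q p n (reciprocal u) \<in> carrier_mat
      (dim_col (lower_toeplitz p q n u)) (dim_row (lower_toeplitz p q n u))"
    using lower_toeplitz_carrier[of p q n u] by (metis carrier_matD lower_toeplitz_carrier)
  ultimately show ?thesis
    unfolding is_pinv_def toeplitz_reciprocal_left[OF u] toeplitz_reciprocal_right[OF u]
      reciprocal_toeplitz(1)[OF u] dominated_toeplitz(1)[OF u] by simp
qed

lemma pinv_upper_toeplitz:
  assumes u: "dominated p q u"
  shows "pinv (upper_toeplitz p q n u) = upper_toeplitz q p n (reciprocal u)"
  unfolding upper_eq_flip_lower[of u, OF dominatedD(1)[OF u]]
    upper_eq_flip_lower[of "reciprocal u", OF reciprocal_carrier[of u, OF dominatedD(1)[OF u]]]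
  by (rule pinv_unitary_equivalent[OF lower_toeplitz_carrier is_pinv_lower_toeplitz[OF u]
      block_flip_carrier block_flip_involution adjoint_block_flip
      block_flip_carrier block_flip_involution adjoint_block_flip])

section \<open>Hankel matrices of reciprocal sequences\<close>

lemma add_eq_zero_imp_eq_uminus:
  fixes A B :: "complex mat"
  assumes "A + B = 0\<^sub>m m n" "A \<in> carrier_mat m n" "B \<in> carrier_mat m n"
  shows "A = - B"
proof (rule eq_matI)
  fix i j assume "i < dim_row (- B)" "j < dim_col (- B)"
  then have "(A + B) $$ (i, j) = 0 \<and> i < m \<and> j < n" using assms by auto
  then show "A $$ (i, j) = (- B) $$ (i, j)" using assms(2,3) by (auto simp: eq_neg_iff_add_eq_0)
qed (use assms in auto)

text \<open>
  The coefficients of \<open>u r\<close> beyond the first vanish, so \<open>L\<^sub>u G\<^sub>r + G\<^sub>u L\<^sub>r = 0\<close>.  Multiply by \<open>L\<^sub>r\<close> from the left, or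
  by \<open>L\<^sub>u\<close> from the right.
\<close>
lemma corner_reciprocal:
  assumes u: "dominated p q u"
  shows "corner q p n (reciprocal u)
      = - (lower_toeplitz q p n (reciprocal u) * corner p q n u * lower_toeplitz q p n (reciprocal u))"
    and "corner p q n u
      = - (lower_toeplitz p q n u * corner q p n (reciprocal u) * lower_toeplitz p q n u)"
proof -
  note D = dominatedD[OF u] and R = reciprocal_carrier[of u, OF dominatedD(1)[OF u]]
  let ?L = "lower_toeplitz p q n u" and ?M = "lower_toeplitz q p n (reciprocal u)"
  let ?G = "corner p q n u" and ?K = "corner q p n (reciprocal u)"
  let ?N = "(n + 1) * p" and ?O = "(n + 1) * q"
  have c: "?L \<in> carrier_mat ?N ?O" "?M \<in> carrier_mat ?O ?N" "?G \<in> carrier_mat ?N ?O"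
    "?K \<in> carrier_mat ?O ?N" by (rule lower_toeplitz_carrier corner_carrier)+
  have LK: "?L * ?K \<in> carrier_mat ?N ?N" and GM: "?G * ?M \<in> carrier_mat ?N ?N"
    using c by (auto intro: mult_carrier_mat)
  have "corner p p n (conv p p u (reciprocal u)) = 0\<^sub>m ?N ?N"
    unfolding corner_def
    by (rule block_mat_eqI[symmetric]) (use block_index_bound in \<open>auto simp: conv_reciprocal[OF u]\<close>)
  then have "?L * ?K + ?G * ?M = 0\<^sub>m ?N ?N"
    using corner_conv[of u, OF D(1) R] by simp
  then have eq: "?L * ?K = - (?G * ?M)"
    using LK GM by (rule add_eq_zero_imp_eq_uminus)
  have "?K = ?M * ?L * ?K"
    unfolding toeplitz_reciprocal_left[OF u] by (rule reciprocal_toeplitz(3)[OF u, symmetric])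
  also have "\<dots> = - (?M * (?G * ?M))"
    unfolding assoc_mult_mat[OF c(2,1,4)] eq
    by (rule uminus_mult_right_mat) (use carrier_matD[OF c(2)] carrier_matD[OF GM] in simp)
  also have "?M * (?G * ?M) = ?M * ?G * ?M"
    by (rule assoc_mult_mat[OF c(2,3,2), symmetric])
  finally show "?K = - (?M * ?G * ?M)" .
  have "?G * (?M * ?L) = ?G"
    unfolding toeplitz_reciprocal_left[OF u] by (rule dominated_toeplitz(4)[OF u])
  then have "?G = ?G * ?M * ?L" unfolding assoc_mult_mat[OF c(3,2,1)] by simp
  also have "?G * ?M = - (?L * ?K)" using eq GM by simp
  also have "- (?L * ?K) * ?L = - (?L * ?K * ?L)"
    by (rule uminus_mult_left_mat) (use carrier_matD[OF c(1)] carrier_matD[OF LK] in simp)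
  finally show "?G = - (?L * ?K * ?L)" .
qed

lemma insert_flip:
  assumes "A \<in> carrier_mat m ((n + 1) * p)" "B \<in> carrier_mat ((n + 1) * p) ((n + 1) * q)"
    "C \<in> carrier_mat ((n + 1) * q) ((n + 1) * r)"
  shows "A * (B * block_flip n q) * (block_flip n q * C * block_flip n r)
    = A * B * C * block_flip n r"
proof -
  let ?J = "block_flip n q" and ?J' = "block_flip n r"
  have J: "?J \<in> carrier_mat ((n + 1) * q) ((n + 1) * q)"
    and J': "?J' \<in> carrier_mat ((n + 1) * r) ((n + 1) * r)"
    by (rule block_flip_carrier)+
  have AB: "A * B \<in> carrier_mat m ((n + 1) * q)" and CJ: "C * ?J' \<in> carrier_mat ((n + 1) * q) ((n + 1) * r)"
    by (rule mult_carrier_mat[OF assms(1,2)], rule mult_carrier_mat[OF assms(3) J'])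
  have "A * (B * ?J) * (?J * C * ?J') = A * B * ?J * (?J * (C * ?J'))"
    unfolding assoc_mult_mat[OF J assms(3) J'] assoc_mult_mat[OF assms(1,2) J] ..
  also have "\<dots> = A * B * (?J * (?J * (C * ?J')))"
    by (rule assoc_mult_mat[OF AB J mult_carrier_mat[OF J CJ]])
  also have "?J * (?J * (C * ?J')) = C * ?J'"
    unfolding assoc_mult_mat[OF J J CJ, symmetric] block_flip_involution
    by (rule left_mult_one_mat[OF CJ])
  also have "A * B * (C * ?J') = A * B * C * ?J'"
    by (rule assoc_mult_mat[OF AB assms(3) J', symmetric])
  finally show ?thesis .
qed

text \<open>
  Multiply the two formulas for the corner matrices by the block reversal from the right, and insert its square
  before the last factor, which thereby becomes upper triangular.
\<close>
lemma hankel_reciprocal: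
  assumes u: "dominated p q u"
  shows "hankel q p n (\<lambda>j. reciprocal u (j + 1))
      = - (lower_toeplitz q p n (reciprocal u) * hankel p q n (\<lambda>j. u (j + 1))
           * upper_toeplitz q p n (reciprocal u))"
    and "hankel p q n (\<lambda>j. u (j + 1))
      = - (lower_toeplitz p q n u * hankel q p n (\<lambda>j. reciprocal u (j + 1)) * upper_toeplitz p q n u)"
proof -
  note D = dominatedD[OF u] and R = reciprocal_carrier[of u, OF dominatedD(1)[OF u]]
  note h1 = hankel_eq_corner_flip[of u, OF D(1)] and h2 = hankel_eq_corner_flip[of "reciprocal u", OF R]
  have neg: "- M * block_flip n r = - (M * block_flip n r)"
    if "M \<in> carrier_mat m ((n + 1) * r)" for M m r
    by (rule uminus_mult_left_mat)
      (use carrier_matD[OF that] carrier_matD[OF block_flip_carrier[of n r]] in simp)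
  have c: "lower_toeplitz q p n (reciprocal u) * corner p q n u * lower_toeplitz q p n (reciprocal u)
      \<in> carrier_mat ((n + 1) * q) ((n + 1) * p)"
    "lower_toeplitz p q n u * corner q p n (reciprocal u) * lower_toeplitz p q n u
      \<in> carrier_mat ((n + 1) * p) ((n + 1) * q)"
    by (rule mult_carrier_mat[OF mult_carrier_mat[OF lower_toeplitz_carrier corner_carrier]
        lower_toeplitz_carrier])+
  show "hankel q p n (\<lambda>j. reciprocal u (j + 1))
      = - (lower_toeplitz q p n (reciprocal u) * hankel p q n (\<lambda>j. u (j + 1))
           * upper_toeplitz q p n (reciprocal u))"
    unfolding h1 h2 upper_eq_flip_lower[of "reciprocal u", OF R]
      insert_flip[OF lower_toeplitz_carrier corner_carrier lower_toeplitz_carrier]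
    by (subst corner_reciprocal(1)[OF u]) (rule neg[OF c(1)])
  show "hankel p q n (\<lambda>j. u (j + 1))
      = - (lower_toeplitz p q n u * hankel q p n (\<lambda>j. reciprocal u (j + 1)) * upper_toeplitz p q n u)"
    unfolding h1 h2 upper_eq_flip_lower[of u, OF D(1)]
      insert_flip[OF lower_toeplitz_carrier corner_carrier lower_toeplitz_carrier]
    by (subst corner_reciprocal(2)[OF u]) (rule neg[OF c(2)])
qed

section \<open>The plus transform and the geometric series\<close>

lemma plus_transform_0 [simp]: "plus_transform \<alpha> s 0 = s 0"
  by (simp add: plus_transform_def)

lemma plus_transform_carrier:
  assumes "\<And>j. s j \<in> carrier_mat p q"
  shows "plus_transform \<alpha> s j \<in> carrier_mat p q"
  using assms by (simp add: plus_transform_def)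

lemma dominated_plus_transform:
  assumes s: "dominated p q s"
  shows "dominated p q (plus_transform \<alpha> s)"
  unfolding dominated_def plus_transform_0
proof (intro allI conjI)
  note D = dominatedD[OF s]
  fix j
  show "plus_transform \<alpha> s j \<in> carrier_mat p q" by (rule plus_transform_carrier[OF D(1)])
  have sm: "(- \<alpha>) \<cdot>\<^sub>m s k \<in> carrier_mat p q" for k using D(1) by simp
  show "s 0 * pinv (s 0) * plus_transform \<alpha> s j = plus_transform \<alpha> s j"
    using D(2) by (simp add: plus_transform_def mult_add_distrib_mat[OF D(5) sm D(1)]
        mult_smult_distrib[OF D(5) D(1)])
  show "plus_transform \<alpha> s j * (pinv (s 0) * s 0) = plus_transform \<alpha> s j"
    using D(3) by (simp add: plus_transform_def add_mult_distrib_mat[OF sm D(1) D(6)]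
        mult_smult_assoc_mat[OF D(1) D(6)])
qed

text \<open>
  The power series of \<open>(1 - \<alpha> z)\<^sup>-\<^sup>1\<close>, whose coefficients are scalar matrices.
\<close>
definition geometric :: "nat \<Rightarrow> complex \<Rightarrow> nat \<Rightarrow> complex mat" where
  "geometric q \<alpha> j = \<alpha> ^ j \<cdot>\<^sub>m 1\<^sub>m q"

lemma geometric_carrier [simp]: "geometric q \<alpha> j \<in> carrier_mat q q"
  by (simp add: geometric_def)

lemma geometric_mult_left:
  "M \<in> carrier_mat p q \<Longrightarrow> geometric p \<alpha> j * M = \<alpha> ^ j \<cdot>\<^sub>m M"
  unfolding geometric_def by (subst mult_smult_assoc_mat[of _ p p]) auto

lemma geometric_mult_right:
  "M \<in> carrier_mat p q \<Longrightarrow> M * geometric q \<alpha> j = \<alpha> ^ j \<cdot>\<^sub>m M"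
  unfolding geometric_def by (subst mult_smult_distrib[of _ p q]) auto

lemma geometric_telescope:
  fixes x :: "nat \<Rightarrow> 'a :: comm_ring_1"
  shows "(\<Sum>l\<le>j. \<alpha> ^ (j - l) * (if l = 0 then x 0 else - \<alpha> * x (l - 1) + x l)) = x j"
proof (induction j)
  case (Suc j)
  have "(\<Sum>l\<le>j. \<alpha> ^ (Suc j - l) * (if l = 0 then x 0 else - \<alpha> * x (l - 1) + x l))
    = \<alpha> * (\<Sum>l\<le>j. \<alpha> ^ (j - l) * (if l = 0 then x 0 else - \<alpha> * x (l - 1) + x l))"
    unfolding sum_distrib_left by (intro sum.cong refl) (simp add: Suc_diff_le mult.assoc)
  then show ?case using Suc by simp
qed simp

lemma plus_transform_index:
  assumes "\<And>j. s j \<in> carrier_mat p q" "a < p" "b < q"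
  shows "plus_transform \<alpha> s l $$ (a, b)
    = (if l = 0 then s 0 $$ (a, b) else - \<alpha> * s (l - 1) $$ (a, b) + s l $$ (a, b))"
  using assms(1)[of l] assms(1)[of "l - 1"] assms(2,3) by (simp add: plus_transform_def)

lemma conv_geometric_left:
  assumes s: "\<And>j. s j \<in> carrier_mat p q"
  shows "conv p q (geometric p \<alpha>) (plus_transform \<alpha> s) j = s j"
proof (rule eq_matI)
  fix a b assume "a < dim_row (s j)" "b < dim_col (s j)"
  then have ab: "a < p" "b < q" using s[of j] by auto
  note u = plus_transform_carrier[of s, OF s]
  have "conv p q (geometric p \<alpha>) (plus_transform \<alpha> s) j $$ (a, b)
    = (\<Sum>l\<le>j. \<alpha> ^ (j - l) * plus_transform \<alpha> s l $$ (a, b))"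
    using ab carrier_matD[OF u] by (simp add: conv_def geometric_mult_left[OF u])
  also have "\<dots> = s j $$ (a, b)"
    unfolding plus_transform_index[of s, OF s ab]
    by (rule geometric_telescope[of \<alpha> j "\<lambda>l. s l $$ (a, b)"])
  finally show "conv p q (geometric p \<alpha>) (plus_transform \<alpha> s) j $$ (a, b) = s j $$ (a, b)" .
qed (use s[of j] in \<open>auto simp: conv_def\<close>)

lemma sum_reverse: "(\<Sum>l\<le>j. f (j - l) l) = (\<Sum>l\<le>j. f l (j - l))"
  for f :: "nat \<Rightarrow> nat \<Rightarrow> 'a :: comm_monoid_add"
  by (rule sum.reindex_bij_witness[of _ "\<lambda>l. j - l" "\<lambda>l. j - l"]) auto

lemma conv_geometric_commute:
  assumes s: "\<And>j. s j \<in> carrier_mat p q"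
  shows "conv p q s (geometric q \<alpha>) j = conv p q (geometric p \<alpha>) s j"
  unfolding conv_def geometric_mult_left[OF s] geometric_mult_right[OF s]
  using sum_reverse[where f = "\<lambda>i l. (\<alpha> ^ l \<cdot>\<^sub>m s i) $$ _"] by (auto intro: cong_mat)

lemma geometric_toeplitz_commute:
  assumes s: "\<And>j. s j \<in> carrier_mat p q"
  shows "lower_toeplitz p q n s * lower_toeplitz q q n (geometric q \<alpha>)
    = lower_toeplitz p p n (geometric p \<alpha>) * lower_toeplitz p q n s"
  unfolding lower_toeplitz_mult[of s, OF s geometric_carrier]
    lower_toeplitz_mult[of "geometric p \<alpha>", OF geometric_carrier s]
  by (rule lower_toeplitz_cong) (rule conv_geometric_commute[OF s])

lemma geometric_mult_toeplitz:
  assumes s: "\<And>j. s j \<in> carrier_mat p q"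
  shows "lower_toeplitz p p n (geometric p \<alpha>) * lower_toeplitz p q n (plus_transform \<alpha> s)
    = lower_toeplitz p q n s"
  unfolding lower_toeplitz_mult[of "geometric p \<alpha>", OF geometric_carrier plus_transform_carrier[of s, OF s]]
  by (rule lower_toeplitz_cong) (rule conv_geometric_left[OF s])

text \<open>
  In power series this is \<open>((1 - \<alpha> z) s)\<^sup>-\<^sup>1 = s\<^sup>-\<^sup>1 (1 - \<alpha> z)\<^sup>-\<^sup>1\<close>, up to the projections \<open>P\<close> and \<open>Q\<close>.
\<close>
lemma reciprocal_plus_transform:
  assumes s: "dominated p q s"
  shows "lower_toeplitz q p n (reciprocal (plus_transform \<alpha> s))
    = lower_toeplitz q p n (reciprocal s) * lower_toeplitz p p n (geometric p \<alpha>)"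
    (is "?M = ?T * ?C")
proof -
  note D = dominatedD[OF s] and u = dominated_plus_transform[OF s, of \<alpha>]
  let ?u = "plus_transform \<alpha> s" and ?N = "(n + 1) * p" and ?O = "(n + 1) * q"
  let ?L = "lower_toeplitz p q n ?u" and ?P = "block_diag n p p (s 0 * pinv (s 0))"
  have c: "?M \<in> carrier_mat ?O ?N" "?T \<in> carrier_mat ?O ?N" "?C \<in> carrier_mat ?N ?N"
    "?L \<in> carrier_mat ?N ?O" "?P \<in> carrier_mat ?N ?N"
    by (rule lower_toeplitz_carrier block_diag_carrier)+
  have "?M = block_diag n q q (pinv (s 0) * s 0) * ?M"
    using reciprocal_toeplitz(1)[OF u, symmetric] by simp
  also have "\<dots> = ?T * (?C * ?L) * ?M"
    unfolding geometric_mult_toeplitz[OF D(1)] toeplitz_reciprocal_left[OF s] ..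
  also have "\<dots> = ?T * (?C * (?L * ?M))"
    unfolding assoc_mult_mat[OF c(2) mult_carrier_mat[OF c(3,4)] c(1)] assoc_mult_mat[OF c(3,4,1)] ..
  also have "?C * (?L * ?M) = ?P * ?C"
    unfolding toeplitz_reciprocal_right[OF u] plus_transform_0 block_diag_eq_toeplitz
    by (rule geometric_toeplitz_commute[symmetric]) (use D(5) in auto)
  also have "?T * (?P * ?C) = ?T * ?C"
    unfolding assoc_mult_mat[OF c(2,5,3), symmetric] reciprocal_toeplitz(2)[OF s] ..
  finally show ?thesis .
qed

lemma upper_reciprocal_plus_transform:
  assumes s: "dominated p q s"
  shows "upper_toeplitz q p n (reciprocal (plus_transform \<alpha> s))
    = upper_toeplitz q p n (reciprocal s) * upper_toeplitz p p n (geometric p \<alpha>)"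
proof -
  note D = dominatedD[OF s]
  have R: "reciprocal s j \<in> carrier_mat q p"
    "reciprocal (plus_transform \<alpha> s) j \<in> carrier_mat q p" for j
    using D(1)[of 0] by (auto intro!: reciprocal_carrier)
  show ?thesis
    unfolding upper_eq_flip_lower[of "reciprocal s", OF R(1)]
      upper_eq_flip_lower[of "reciprocal (plus_transform \<alpha> s)", OF R(2)]
      upper_eq_flip_lower[of "geometric p \<alpha>", OF geometric_carrier]
      assoc_mult_mat[OF block_flip_carrier lower_toeplitz_carrier[of q p] block_flip_carrier]
      insert_flip[OF block_flip_carrier lower_toeplitz_carrier lower_toeplitz_carrier]
      reciprocal_plus_transform[OF s]
      assoc_mult_mat[OF block_flip_carrier lower_toeplitz_carrier lower_toeplitz_carrier]
      assoc_mult_mat[OF block_flip_carrier mult_carrier_mat[OF lower_toeplitz_carrier lower_toeplitz_carrier] block_flip_carrier]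
    ..
qed

lemma resolvent_eq_lower_toeplitz:
  "q \<ge> 1 \<Longrightarrow> resolvent q n \<alpha> = lower_toeplitz q q n (geometric q \<alpha>)"
  unfolding resolvent_blocks lower_toeplitz_def geometric_def ..

lemma adjoint_resolvent_eq_upper_toeplitz:
  assumes "p \<ge> 1"
  shows "mat_adjoint (resolvent p n (cnj \<alpha>)) = upper_toeplitz p p n (geometric p \<alpha>)"
proof -
  have *: "mat_adjoint (cnj \<alpha> ^ j \<cdot>\<^sub>m 1\<^sub>m p) = \<alpha> ^ j \<cdot>\<^sub>m (1\<^sub>m p :: complex mat)" for j
    by (rule eq_matI) auto
  show ?thesis
    unfolding resolvent_blocks[OF assms] upper_toeplitz_def geometric_def
    by (subst block_mat_adjoint) (auto simp: * intro!: block_mat_cong)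
qed

lemma H_shift_eq_K_plus: "H_shift p q \<alpha> n s = K_plus p q \<alpha> n s"
  unfolding H_shift_def K_plus_def
  by (rule arg_cong[where f = "hankel p q n"]) (auto simp: shift_transform_def plus_transform_def)

section \<open>Almost dominated sequences\<close>

text \<open>
  The columns of \<open>s\<^sub>j\<close> lie in the column space of \<open>s\<^sub>0\<close>, which \<open>s\<^sub>0 D\<close> fixes; and the columns of
  \<open>I - D s\<^sub>0\<close> lie in the null space of \<open>s\<^sub>0\<close>, hence in that of \<open>s\<^sub>j\<close>.
\<close>
lemma first_term_dominated_absorb:
  assumes "first_term_dominated p q m s" "j \<le> m"
  shows "s 0 * pinv (s 0) * s j = s j" "s j * (pinv (s 0) * s 0) = s j"
proof -
  interpret vec_space "TYPE(complex)" p .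
  have s0: "s 0 \<in> carrier_mat p q" and sj: "s j \<in> carrier_mat p q"
    and ker: "mat_kernel (s 0) \<subseteq> mat_kernel (s j)" and ran: "col_space (s j) \<subseteq> col_space (s 0)"
    using assms unfolding first_term_dominated_def by auto
  note D = pinv_carrier[OF s0]
  have P: "s 0 * pinv (s 0) \<in> carrier_mat p p" and Q: "pinv (s 0) * s 0 \<in> carrier_mat q q"
    using s0 D by auto
  show "s 0 * pinv (s 0) * s j = s j"
  proof (rule mat_col_eqI)
    fix i assume "i < dim_col (s j)"
    then have i: "i < q" using sj by auto
    have "col (s j) i = s j *\<^sub>v unit_vec q i" using mat_mult_unit_vec[OF sj i] by simp
    moreover have "col (s j) i \<in> carrier_vec p" using sj i by auto
    ultimately have "col (s j) i \<in> col_space (s j)" unfolding col_space_eq[OF sj] using sj i by force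
    then obtain x where x: "x \<in> carrier_vec q" "s 0 *\<^sub>v x = col (s j) i"
      using ran col_space_eq[OF s0] s0 by auto
    have "col (s 0 * pinv (s 0) * s j) i = s 0 * pinv (s 0) *\<^sub>v (s 0 *\<^sub>v x)"
      using col_mult2[OF P sj i] x by simp
    also have "\<dots> = col (s j) i"
      using assoc_mult_mat_vec[OF P s0 x(1)] x by (simp add: pinv_props)
    finally show "col (s 0 * pinv (s 0) * s j) i = col (s j) i" .
  qed (use sj s0 in auto)
  show "s j * (pinv (s 0) * s 0) = s j"
  proof (rule mat_col_eqI)
    fix i assume "i < dim_col (s j)"
    then have i: "i < q" using sj by auto
    let ?e = "unit_vec q i :: complex vec" and ?v = "pinv (s 0) * s 0 *\<^sub>v unit_vec q i"
    have v: "?v \<in> carrier_vec q" using Q by auto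
    have "s 0 *\<^sub>v ?v = s 0 *\<^sub>v ?e"
      using assoc_mult_mat_vec[OF s0 Q unit_vec_carrier] assoc_mult_mat[OF s0 D s0]
      by (simp add: pinv_props)
    then have "s 0 *\<^sub>v (?e - ?v) = 0\<^sub>v p"
      using mult_minus_distrib_mat_vec[OF s0 _ v, of ?e] s0 by simp
    then have "?e - ?v \<in> mat_kernel (s 0)" using v by (intro mat_kernelI[OF s0]) auto
    then have "s j *\<^sub>v (?e - ?v) = 0\<^sub>v p" using ker mat_kernelD[OF sj] by auto
    then have 0: "s j *\<^sub>v ?e - s j *\<^sub>v ?v = 0\<^sub>v p"
      using mult_minus_distrib_mat_vec[OF sj _ v, of ?e] by simp
    have "s j *\<^sub>v ?v = s j *\<^sub>v ?e"
    proof (rule eq_vecI)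
      fix k assume "k < dim_vec (s j *\<^sub>v ?e)"
      then have k: "k < p" using sj by simp
      have "(s j *\<^sub>v ?e - s j *\<^sub>v ?v) $ k = 0" using 0 k by simp
      then show "(s j *\<^sub>v ?v) $ k = (s j *\<^sub>v ?e) $ k" using k sj
        by (simp del: index_mult_mat_vec)
    qed simp
    then show "col (s j * (pinv (s 0) * s 0)) i = col (s j) i"
      using col_mult2[OF sj Q i] mat_mult_unit_vec[OF sj i] mat_mult_unit_vec[OF Q i] by simp
  qed (use sj s0 in auto)
qed

text \<open>
  The last term \<open>u\<^sub>m\<close> occurs in the reciprocal up to index \<open>m\<close> only once, in the form \<open>D u\<^sub>m D\<close>.  So its
  components outside the column space and the row space of \<open>u\<^sub>0\<close> are invisible.
\<close>
lemma reciprocal_cong: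
  assumes u: "\<And>j. j \<le> m \<Longrightarrow> u j \<in> carrier_mat p q" and v: "\<And>j. j \<le> m \<Longrightarrow> v j \<in> carrier_mat p q"
    and m: "m \<ge> 1" and eq: "\<And>j. j < m \<Longrightarrow> u j = v j"
    and last: "pinv (u 0) * (u m * pinv (u 0)) = pinv (u 0) * (v m * pinv (u 0))"
    and "j \<le> m"
  shows "reciprocal u j = reciprocal v j"
  using \<open>j \<le> m\<close>
proof (induction j rule: less_induct)
  case (less j)
  have uv0: "u 0 = v 0" using eq m by simp
  have D: "pinv (v 0) \<in> carrier_mat q p" by (rule pinv_carrier[OF v]) simp
  have d: "dim_row (v 0) = p" using v[of 0] by simp
  have Ru: "reciprocal u l \<in> carrier_mat q p" and Rv: "reciprocal v l \<in> carrier_mat q p" for l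
    using u v by (auto intro: reciprocal_carrier)
  show ?case
  proof (cases "j = 0")
    case True
    then show ?thesis by (simp add: reciprocal_0 uv0)
  next
    case False
    have cu: "u (j - l) * reciprocal u l \<in> carrier_mat p p" for l
      by (rule mult_carrier_mat[OF u Ru]) (use less.prems in simp)
    have cv: "v (j - l) * reciprocal v l \<in> carrier_mat p p" for l
      by (rule mult_carrier_mat[OF v Rv]) (use less.prems in simp)
    have summand: "pinv (v 0) * (u (j - l) * reciprocal u l) = pinv (v 0) * (v (j - l) * reciprocal v l)"
      if "l < j" for l
    proof (cases "j - l < m")
      case True
      then show ?thesis using eq less that by simp
    next
      case False
      then have "l = 0" "j = m" using that less.prems by auto
      then show ?thesis using last by (simp add: reciprocal_0 uv0)
    qed
    have "pinv (v 0) * reciprocal_tail u j = pinv (v 0) * reciprocal_tail v j"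
      unfolding reciprocal_tail_def uv0 d mult_entry_sum[OF D cu] mult_entry_sum[OF D cv]
      using summand by (intro cong_mat refl sum.cong) auto
    then show ?thesis using False by (simp add: reciprocal_pos uv0)
  qed
qed

text \<open>
  This removes the correction \<open>\<Xi>\<close>: the outer factors absorb the projections \<open>P\<close> and \<open>Q\<close>, which kill \<open>X\<close>
  from the two sides jointly.
\<close>
lemma toeplitz_annihilates_corner_block:
  assumes y: "\<And>j. y j \<in> carrier_mat q p" and P: "P \<in> carrier_mat p p" and Q: "Q \<in> carrier_mat q q"
    and X: "X \<in> carrier_mat p q"
    and yP: "\<And>j. y j * P = y j" and Qy: "\<And>j. Q * y j = y j" and PXQ: "P * X * Q = 0\<^sub>m p q"
    and Z: "Z = block_mat n p q (\<lambda>j k. if j = n \<and> k = n then X else 0\<^sub>m p q)"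
  shows "lower_toeplitz q p n y * Z * upper_toeplitz q p n y = 0\<^sub>m ((n + 1) * q) ((n + 1) * p)"
proof -
  let ?L = "lower_toeplitz q p n y" and ?U = "upper_toeplitz q p n y"
  let ?P = "block_diag n p p P" and ?Q = "block_diag n q q Q"
  have c: "?L \<in> carrier_mat ((n + 1) * q) ((n + 1) * p)" "?U \<in> carrier_mat ((n + 1) * q) ((n + 1) * p)"
    "?P \<in> carrier_mat ((n + 1) * p) ((n + 1) * p)" "?Q \<in> carrier_mat ((n + 1) * q) ((n + 1) * q)"
    "Z \<in> carrier_mat ((n + 1) * p) ((n + 1) * q)"
    unfolding Z by (rule lower_toeplitz_carrier upper_toeplitz_carrier block_diag_carrier block_mat_carrier)+
  have L: "?L * ?P = ?L"
    unfolding lower_toeplitz_def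
    by (subst mult_block_diag) (use P y yP left_mult_zero_mat[OF P] in \<open>auto intro!: block_mat_cong\<close>)
  have U: "?Q * ?U = ?U"
    unfolding upper_toeplitz_def
    by (subst block_diag_mult) (use Q y Qy right_mult_zero_mat[OF Q] in \<open>auto intro!: block_mat_cong\<close>)
  have "?P * Z * ?Q = block_mat n p q (\<lambda>j k. P * (if j = n \<and> k = n then X else 0\<^sub>m p q) * Q)"
    unfolding Z using P Q X
    by (subst block_diag_mult) (auto intro!: mult_block_diag mult_carrier_mat[OF P])
  also have "\<dots> = 0\<^sub>m ((n + 1) * p) ((n + 1) * q)"
    by (rule block_mat_eqI[symmetric])
      (use block_index_bound PXQ right_mult_zero_mat[OF P] left_mult_zero_mat[OF Q] in auto)
  finally have PZQ: "?P * Z * ?Q = 0\<^sub>m ((n + 1) * p) ((n + 1) * q)" .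
  have PZ: "?P * Z \<in> carrier_mat ((n + 1) * p) ((n + 1) * q)" by (rule mult_carrier_mat[OF c(3,5)])
  have "?L * Z * ?U = ?L * (?P * Z) * (?Q * ?U)"
    unfolding U assoc_mult_mat[OF c(1,3,5), symmetric] L ..
  also have "\<dots> = ?L * (?P * Z * ?Q) * ?U"
    unfolding assoc_mult_mat[OF mult_carrier_mat[OF c(1) PZ] c(4) c(2), symmetric]
      assoc_mult_mat[OF c(1) PZ c(4)] ..
  also have "\<dots> = 0\<^sub>m ((n + 1) * q) ((n + 1) * p)"
    unfolding PZQ right_mult_zero_mat[OF c(1)] left_mult_zero_mat[OF c(2)] ..
  finally show ?thesis .
qed

lemma uminus_triple_product:
  fixes A B C :: "complex mat"
  assumes A: "A \<in> carrier_mat k l" and B: "B \<in> carrier_mat l m" and C: "C \<in> carrier_mat m n"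
  shows "- (A * B * C) = - A * B * C" "- (A * B * C) = A * - B * C"
proof -
  have "- (A * B) * C = - (A * B * C)"
    by (rule uminus_mult_left_mat) (use carrier_matD[OF B] carrier_matD[OF C] in simp)
  moreover have "- A * B = - (A * B)" "A * - B = - (A * B)"
    using carrier_matD[OF A] carrier_matD[OF B] by simp_all
  ultimately show "- (A * B * C) = - A * B * C" "- (A * B * C) = A * - B * C" by simp_all
qed

theorem theorem5p6:
  fixes p q n :: nat and \<alpha> :: complex and s :: "nat \<Rightarrow> complex mat"
  assumes "1 \<le> p" and "1 \<le> q"
    and "nearly_first_term_dominated p q (2 * n + 1) s"
  shows
    "K_sharp p q \<alpha> n s = - (S_sharp p q \<alpha> n s * K_plus p q \<alpha> n s * SS_sharp p q \<alpha> n s) \<and>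
     K_sharp p q \<alpha> n s =
       - (resolvent q n \<alpha> * pinv (lower_toeplitz p q n s) * H_shift p q \<alpha> n s *
          pinv (upper_toeplitz p q n s) * mat_adjoint (resolvent p n (cnj \<alpha>))) \<and>
     K_plus p q \<alpha> n s =
       Xi p q n (2 * n + 1) s - S_plus p q \<alpha> n s * K_sharp p q \<alpha> n s * SS_plus p q \<alpha> n s \<and>
     vec_space.rank ((n + 1) * q) (K_sharp p q \<alpha> n s) =
       vec_space.rank ((n + 1) * p) (K_plus p q \<alpha> n s - Xi p q n (2 * n + 1) s) \<and>
     (p = q \<longrightarrow>
       det (K_sharp p q \<alpha> n s) =
         inverse (det (s 0)) ^ (2 * n + 2) * det (- K_plus p q \<alpha> n s))"
proof -
  define m where "m = 2 * n + 1"
  define D where "D = pinv (s 0)"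
  define P where "P = s 0 * D"
  define Q where "Q = D * s 0"
  \<comment> \<open>The dominated modification of \<open>s\<close>: below \<open>m\<close> it coincides with \<open>s\<close>, and extending it by zero
    makes it dominated at every index.\<close>
  define s' where "s' j = (if j \<le> m then P * s j * Q else 0\<^sub>m p q)" for j
  define X where "X = s m - s 0 * D * s m * D * s 0"
  have sc: "s j \<in> carrier_mat p q" if "j \<le> m" for j
    using assms(3) that unfolding nearly_first_term_dominated_def m_def by auto
  have ftd: "first_term_dominated p q (2 * n) s"
    using assms(3) unfolding nearly_first_term_dominated_def by simp
  have s0: "s 0 \<in> carrier_mat p q" by (rule sc) simp
  have D: "D \<in> carrier_mat q p" unfolding D_def by (rule pinv_carrier[OF s0])
  have P: "P \<in> carrier_mat p p" and Q: "Q \<in> carrier_mat q q"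
    unfolding P_def Q_def using s0 D by auto
  have PP: "P * P = P" and QQ: "Q * Q = Q" and DP: "D * P = D" and QD: "Q * D = D"
    using assoc_mult_mat[OF P s0 D] assoc_mult_mat[OF D P s0] assoc_mult_mat[OF D s0 D]
      assoc_mult_mat[OF s0 D s0] assoc_mult_mat[OF D s0 Q] assoc_mult_mat[OF Q D s0]
    by (simp_all add: P_def Q_def D_def pinv_props)
  have absorb: "P * s j = s j" "s j * Q = s j" if "j < m" for j
    using first_term_dominated_absorb[OF ftd, of j] that
    by (simp_all add: P_def Q_def D_def m_def)
  have s'_eq: "s' j = s j" if "j < m" for j
    using that absorb[OF that] by (simp add: s'_def)
  have s'm: "s' m = P * s m * Q" by (simp add: s'_def)
  have s'0: "s' 0 = s 0" by (rule s'_eq) (simp add: m_def)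
  have dom: "dominated p q s'"
    unfolding dominated_def s'0 D_def[symmetric] P_def[symmetric] Q_def[symmetric]
  proof (intro allI conjI)
    fix j
    show "s' j \<in> carrier_mat p q" using sc[of j] P Q by (auto simp: s'_def)
    show "P * s' j = s' j"
    proof (cases "j \<le> m")
      case True
      note sj = sc[OF True]
      have "P * (P * s j * Q) = P * P * s j * Q"
        using assoc_mult_mat[OF P mult_carrier_mat[OF P sj] Q] assoc_mult_mat[OF P P sj] by simp
      then show ?thesis using True by (simp add: s'_def PP)
    qed (use right_mult_zero_mat[OF P] in \<open>simp add: s'_def\<close>)
    show "s' j * Q = s' j"
    proof (cases "j \<le> m")
      case True
      then show ?thesis
        using assoc_mult_mat[OF mult_carrier_mat[OF P sc[OF True]] Q Q] by (simp add: s'_def QQ)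
    qed (use left_mult_zero_mat[OF Q] in \<open>simp add: s'_def\<close>)
  qed
  define u where "u = plus_transform \<alpha> s'"
  define r where "r = reciprocal u"
  define t where "t = reciprocal s'"
  have u: "dominated p q u" unfolding u_def by (rule dominated_plus_transform[OF dom])
  have u0: "u 0 = s 0" by (simp add: u_def s'0)
  have uc: "u j \<in> carrier_mat p q" for j using dominatedD(1)[OF u] .
  have rc: "r j \<in> carrier_mat q p" for j unfolding r_def by (rule reciprocal_carrier[OF uc])
  have tc: "t j \<in> carrier_mat q p" for j
    unfolding t_def by (rule reciprocal_carrier[OF dominatedD(1)[OF dom]])
  have plus_eq: "plus_transform \<alpha> s j = u j" if "j < m" for j
    using that s'_eq by (simp add: u_def plus_transform_def)
  \<comment> \<open>The correction is written in the form of the definition of \<open>Xi\<close>.\<close>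
  have Psm: "P * s m * Q = s 0 * D * s m * D * s 0"
    using assoc_mult_mat[OF mult_carrier_mat[OF P sc[of m]] D s0] by (simp add: P_def Q_def)
  have Xs: "X = s m - s' m" using Psm by (simp add: X_def s'm)
  have s'mc: "s' m \<in> carrier_mat p q" by (rule dominatedD(1)[OF dom])
  have smc: "s m \<in> carrier_mat p q" by (rule sc) simp
  have X: "X \<in> carrier_mat p q" unfolding Xs by (rule minus_carrier_mat[OF s'mc])
  have m1: "m \<ge> 1" by (simp add: m_def)
  have sm1: "s' (m - 1) = s (m - 1)" by (rule s'_eq) (use m1 in simp)
  have sm1c: "s (m - 1) \<in> carrier_mat p q" by (rule sc) simp
  have plus_m: "plus_transform \<alpha> s m = u m + X"
  proof (rule eq_matI)
    fix a b assume "a < dim_row (u m + X)" "b < dim_col (u m + X)"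
    then have "a < p" "b < q" using X by auto
    then show "plus_transform \<alpha> s m $$ (a, b) = (u m + X) $$ (a, b)"
      using m1 X smc s'mc sm1c by (simp add: u_def plus_transform_def sm1[simplified] Xs)
  qed (use X smc m1 sm1c in \<open>auto simp: plus_transform_def\<close>)
  have PXQ: "P * X * Q = 0\<^sub>m p q"
  proof -
    have "P * (s' m) * Q = s' m" using dominatedD(2,3)[OF dom, of m]
      by (simp add: s'0 P_def Q_def D_def)
    moreover have "P * X = P * s m - P * s' m"
      unfolding Xs by (rule mult_minus_distrib_mat[OF P smc s'mc])
    moreover have "(P * s m - P * s' m) * Q = P * s m * Q - P * s' m * Q"
      by (rule minus_mult_distrib_mat[OF mult_carrier_mat[OF P smc] mult_carrier_mat[OF P s'mc] Q])
    ultimately show ?thesis using s'mc by (auto simp: s'm[symmetric])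
  qed
  have DXD: "D * (X * D) = 0\<^sub>m q p"
  proof -
    have "D * (X * D) = (D * P) * (X * (Q * D))" by (simp add: DP QD)
    also have "\<dots> = D * (P * (X * (Q * D)))"
      by (rule assoc_mult_mat[OF D P]) (use X Q D in auto)
    also have "P * (X * (Q * D)) = P * X * Q * D"
      using assoc_mult_mat[OF mult_carrier_mat[OF P X] Q D] assoc_mult_mat[OF P X mult_carrier_mat[OF Q D]]
      by simp
    also have "D * \<dots> = 0\<^sub>m q p"
      unfolding PXQ left_mult_zero_mat[OF D] by (rule right_mult_zero_mat[OF D])
    finally show ?thesis .
  qed
  \<comment> \<open>Only \<open>D u\<^sub>m D\<close> matters, and \<open>D X D = 0\<close>.\<close>
  have sharp_eq: "sharp \<alpha> s j = r j" if "j \<le> m" for j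
    unfolding sharp_def r_def
  proof (rule reciprocal_cong[OF _ uc m1 plus_eq _ that])
    show "plus_transform \<alpha> s j \<in> carrier_mat p q" if "j \<le> m" for j
      using sc[of j] sc[of "j - 1"] that by (auto simp: plus_transform_def)
    have uD: "u m * D \<in> carrier_mat p p" and XD: "X * D \<in> carrier_mat p p"
      using uc[of m] X D by auto
    have "D * ((u m + X) * D) = D * (u m * D) + D * (X * D)"
      unfolding add_mult_distrib_mat[OF uc X D] by (rule mult_add_distrib_mat[OF D uD XD])
    then show "pinv (plus_transform \<alpha> s 0) * (plus_transform \<alpha> s m * pinv (plus_transform \<alpha> s 0))
      = pinv (plus_transform \<alpha> s 0) * (u m * pinv (plus_transform \<alpha> s 0))"
      using mult_carrier_mat[OF D uD] unfolding plus_m plus_transform_0 D_def[symmetric] DXD by simp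
  qed auto

  define N M where "N = (n + 1) * p" and "M = (n + 1) * q"
  define K where "K = hankel p q n (\<lambda>j. u (j + 1))"
  define R where "R = hankel q p n (\<lambda>j. r (j + 1))"
  define Lr Ur Lu Uu where "Lr = lower_toeplitz q p n r" and "Ur = upper_toeplitz q p n r"
    and "Lu = lower_toeplitz p q n u" and "Uu = upper_toeplitz p q n u"
  define Z where "Z = Xi p q n m s"
  have Z_eq: "Z = block_mat n p q (\<lambda>j k. if j = n \<and> k = n then X else 0\<^sub>m p q)"
    unfolding Z_def Xi_def X_def D_def ..
  have c: "K \<in> carrier_mat N M" "R \<in> carrier_mat M N" "Lr \<in> carrier_mat M N" "Ur \<in> carrier_mat M N"
    "Lu \<in> carrier_mat N M" "Uu \<in> carrier_mat N M" "Z \<in> carrier_mat N M"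
    unfolding K_def R_def Lr_def Ur_def Lu_def Uu_def Z_eq hankel_def N_def M_def
    by (rule block_mat_carrier lower_toeplitz_carrier upper_toeplitz_carrier)+
  have nm: "j + k + 1 \<le> m" if "j \<le> n" "k \<le> n" for j k using that by (simp add: m_def)
  have Ks: "K_sharp p q \<alpha> n s = R"
    unfolding K_sharp_def R_def hankel_def using nm by (intro block_mat_cong sharp_eq) auto
  have Ss: "S_sharp p q \<alpha> n s = Lr" "SS_sharp p q \<alpha> n s = Ur"
    unfolding S_sharp_def Lr_def lower_toeplitz_def SS_sharp_def Ur_def upper_toeplitz_def
    using sharp_eq by (auto intro!: block_mat_cong simp: m_def)
  have Sp: "S_plus p q \<alpha> n s = Lu" "SS_plus p q \<alpha> n s = Uu"
    unfolding S_plus_def Lu_def lower_toeplitz_def SS_plus_def Uu_def upper_toeplitz_def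
    using plus_eq by (auto intro!: block_mat_cong simp: m_def)
  have Kp: "K_plus p q \<alpha> n s = K + Z"
  proof -
    have "K + Z = block_mat n p q (\<lambda>j k. plus_transform \<alpha> s (j + k + 1))"
    proof (rule block_mat_eqI)
      show "K + Z \<in> carrier_mat ((n + 1) * p) ((n + 1) * q)" using c by (simp add: N_def M_def)
      fix j k a b assume *: "j \<le> n" "k \<le> n" "a < p" "b < q"
      have "(K + Z) $$ (j * p + a, k * q + b) = K $$ (j * p + a, k * q + b) + Z $$ (j * p + a, k * q + b)"
        by (rule index_add_mat(1))
          (use carrier_matD[OF c(7)] block_index_bound[OF *(1,3)] block_index_bound[OF *(2,4)] in
            \<open>simp_all add: N_def M_def\<close>)
      also have "\<dots> = u (j + k + 1) $$ (a, b) + (if j = n \<and> k = n then X else 0\<^sub>m p q) $$ (a, b)"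
        unfolding K_def Z_eq hankel_def block_mat_index[OF *] ..
      also have "\<dots> = plus_transform \<alpha> s (j + k + 1) $$ (a, b)"
      proof (cases "j = n \<and> k = n")
        case True
        then have "j + k + 1 = m" by (simp add: m_def)
        then show ?thesis using True * X uc[of m] plus_m by simp
      next
        case False
        then have "j + k + 1 < m" using * by (auto simp: m_def)
        then show ?thesis using False * plus_eq by auto
      qed
      finally show "(K + Z) $$ (j * p + a, k * q + b) = plus_transform \<alpha> s (j + k + 1) $$ (a, b)" .
    qed
    then show ?thesis unfolding K_plus_def hankel_def by simp
  qed
  have RK: "R = - (Lr * K * Ur)" and KR: "K = - (Lu * R * Uu)"
    using hankel_reciprocal[OF u] unfolding R_def K_def Lr_def Ur_def Lu_def Uu_def r_def by auto
  \<comment> \<open>Needed for the reciprocals of both \<open>u\<close> and \<open>s'\<close>, hence for general \<open>y\<close>.\<close>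
  have cancel_Z: "lower_toeplitz q p n y * (K + Z) * upper_toeplitz q p n y
      = lower_toeplitz q p n y * K * upper_toeplitz q p n y"
    if y: "\<And>j. y j \<in> carrier_mat q p" "\<And>j. y j * P = y j" "\<And>j. Q * y j = y j" for y
  proof -
    have L: "lower_toeplitz q p n y \<in> carrier_mat M N" and U: "upper_toeplitz q p n y \<in> carrier_mat M N"
      unfolding M_def N_def by (rule lower_toeplitz_carrier upper_toeplitz_carrier)+
    have "lower_toeplitz q p n y * (K + Z) * upper_toeplitz q p n y
      = lower_toeplitz q p n y * K * upper_toeplitz q p n y
        + lower_toeplitz q p n y * Z * upper_toeplitz q p n y"
      unfolding mult_add_distrib_mat[OF L c(1,7)]
      by (rule add_mult_distrib_mat[OF mult_carrier_mat[OF L c(1)] mult_carrier_mat[OF L c(7)] U])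
    also have "lower_toeplitz q p n y * Z * upper_toeplitz q p n y = 0\<^sub>m M N"
      unfolding M_def N_def
      by (rule toeplitz_annihilates_corner_block[OF y(1) P Q X y(2,3) PXQ Z_eq])
    finally show ?thesis
      using mult_carrier_mat[OF mult_carrier_mat[OF L c(1)] U] by simp
  qed
  have rPQ: "r j * P = r j" "Q * r j = r j" for j
    using reciprocal_dominated[OF u, of j] by (simp_all add: r_def u0 P_def Q_def D_def)
  have tPQ: "t j * P = t j" "Q * t j = t j" for j
    using reciprocal_dominated[OF dom, of j] by (simp_all add: t_def s'0 P_def Q_def D_def)
  have LKU: "Lr * (K + Z) * Ur = Lr * K * Ur"
    unfolding Lr_def Ur_def by (rule cancel_Z[OF rc rPQ])
  have a1: "R = - (Lr * (K + Z) * Ur)" unfolding LKU by (rule RK)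

  let ?C = "lower_toeplitz q q n (geometric q \<alpha>)" and ?E = "upper_toeplitz p p n (geometric p \<alpha>)"
  let ?T = "lower_toeplitz q p n t" and ?V = "upper_toeplitz q p n t"
  have c': "?C \<in> carrier_mat M M" "?E \<in> carrier_mat N N" "?T \<in> carrier_mat M N" "?V \<in> carrier_mat M N"
    unfolding M_def N_def by (rule lower_toeplitz_carrier upper_toeplitz_carrier)+
  \<comment> \<open>The geometric series is pulled out to the left in the first factor and to the right in the last.\<close>
  have Lr_fac: "Lr = ?C * ?T"
    unfolding Lr_def r_def u_def t_def reciprocal_plus_transform[OF dom]
    by (rule geometric_toeplitz_commute[OF tc[unfolded t_def]])
  have Ur_fac: "Ur = ?V * ?E"
    unfolding Ur_def r_def u_def t_def by (rule upper_reciprocal_plus_transform[OF dom])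
  have low: "lower_toeplitz p q n s = lower_toeplitz p q n s'"
    "upper_toeplitz p q n s = upper_toeplitz p q n s'"
    unfolding lower_toeplitz_def upper_toeplitz_def
    using s'_eq by (auto intro!: block_mat_cong simp: m_def)
  have pl: "pinv (lower_toeplitz p q n s) = ?T" "pinv (upper_toeplitz p q n s) = ?V"
    unfolding low t_def by (rule pinv_eqI[OF is_pinv_lower_toeplitz[OF dom]] pinv_upper_toeplitz[OF dom])+
  have TKV: "?T * (K + Z) * ?V = ?T * K * ?V" by (rule cancel_Z[OF tc tPQ])
  have "Lr * K * Ur = ?C * (?T * K * ?V) * ?E"
  proof -
    have TK: "?T * K \<in> carrier_mat M M" by (rule mult_carrier_mat[OF c'(3) c(1)])
    have "Lr * K * Ur = ?C * (?T * K) * (?V * ?E)"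
      unfolding Lr_fac Ur_fac assoc_mult_mat[OF c'(1,3) c(1)] ..
    also have "\<dots> = ?C * (?T * K) * ?V * ?E"
      by (rule assoc_mult_mat[OF mult_carrier_mat[OF c'(1) TK] c'(4,2), symmetric])
    finally show ?thesis unfolding assoc_mult_mat[OF c'(1) TK c'(4)] .
  qed
  also have "\<dots> = ?C * (?T * (K + Z) * ?V) * ?E" unfolding TKV ..
  also have "\<dots> = ?C * ?T * (K + Z) * ?V * ?E"
  proof -
    have KZ: "K + Z \<in> carrier_mat N M" using c by simp
    show ?thesis
      unfolding assoc_mult_mat[OF c'(1,3) KZ]
        assoc_mult_mat[OF c'(1) mult_carrier_mat[OF c'(3) KZ] c'(4)] ..
  qed
  finally have a2: "R = - (?C * ?T * (K + Z) * ?V * ?E)" using RK by simp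

  have LRU: "Lu * R * Uu \<in> carrier_mat N M"
    by (rule mult_carrier_mat[OF mult_carrier_mat[OF c(5,2)] c(6)])
  have b: "K + Z = Z - Lu * R * Uu"
  proof -
    have "- A + B = B - A" if "A \<in> carrier_mat N M" "B \<in> carrier_mat N M" for A B :: "complex mat"
      using that by (intro eq_matI) auto
    from this[OF LRU c(7)] show ?thesis by (subst KR)
  qed
  have KZZ: "K + Z - Z = K" using c(1,7) by (intro eq_matI) auto
  have "R = (- Lr) * K * Ur"
    by (subst RK) (rule uminus_triple_product(1)[OF c(3,1,4)])
  \<comment> \<open>The two product formulas bound each rank by the other.\<close>
  then have rk1: "vec_space.rank M R \<le> vec_space.rank N K"
    using rank_mult_both_sides_le[OF c(1) _ c(4), of "- Lr" M] c(3) by simp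
  have "K = (- Lu) * R * Uu"
    by (subst KR) (rule uminus_triple_product(1)[OF c(5,2,6)])
  then have rk2: "vec_space.rank N K \<le> vec_space.rank M R"
    using rank_mult_both_sides_le[OF c(2) _ c(6), of "- Lu" N] c(5) by simp
  have d: "det R = inverse (det (s 0)) ^ (2 * n + 2) * det (- (K + Z))" if "p = q"
  proof -
    have NM: "N = M" by (simp add: N_def M_def that)
    have KZ: "K + Z \<in> carrier_mat N N" using c by (simp add: NM)
    have Lc: "Lr \<in> carrier_mat N N" "Ur \<in> carrier_mat N N" using c by (simp_all add: NM)
    have rc': "r j \<in> carrier_mat p p" for j using rc that by simp
    have dr: "det (r 0) = inverse (det (s 0))"
      unfolding r_def reciprocal_0 u0 using det_pinv[of "s 0" p] s0 that by simp
    have "R = Lr * (- (K + Z)) * Ur"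
      by (subst a1) (rule uminus_triple_product(2)[OF Lc(1) KZ Lc(2)])
    then have "det R = det Lr * det (- (K + Z)) * det Ur"
      using det_mult[OF mult_carrier_mat[OF Lc(1), of "- (K + Z)"] Lc(2)]
        det_mult[OF Lc(1), of "- (K + Z)"] KZ by simp
    also have "det Lr = det (r 0) ^ (n + 1)"
      unfolding Lr_def that[symmetric] by (rule det_lower_toeplitz[OF rc'])
    also have "det Ur = det (r 0) ^ (n + 1)"
      unfolding Ur_def that[symmetric] by (rule det_upper_toeplitz[OF rc'])
    finally have "det R = det (r 0) ^ ((n + 1) + (n + 1)) * det (- (K + Z))"
      by (simp only: power_add mult_ac)
    then show ?thesis unfolding dr by (simp add: mult_2)
  qed
  show ?thesis
    unfolding Ks Ss Sp H_shift_eq_K_plus Kp pl resolvent_eq_lower_toeplitz[OF assms(2)]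
      adjoint_resolvent_eq_upper_toeplitz[OF assms(1)] m_def[symmetric] Z_def[symmetric] KZZ
      M_def[symmetric] N_def[symmetric]
    by (intro conjI impI a1 a2 b d le_antisym[OF rk1 rk2])
qed

end
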